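(* Consider the random-order secretary problem with an $\alpha$-power signal (defined in the context), and let $\mathrm{OPT}_n(\alpha)$ denote the optimal success probability on instances of length $n$. For every $\alpha\ge 1$, the policy $\mathcal{A}(S)$ is optimal (for every $n$). For every $0<\alpha<1$ there is, for each $n$, a threshold $k_n\in[n]$ such that the policy $\mathcal{A}(\max\{S,k_n\})$ is optimal, and $\frac{k_n}{n}\to(1-\alpha)^{1/\alpha}$ as $n\to\infty$. Moreover, for every fixed $\alpha>0$, $$\mathrm{OPT}_n(\alpha)\xrightarrow{n\to\infty}\mathrm{OPT}(\alpha):=\begin{cases}\dfrac{\alpha+(1-\alpha)^{1+1/\alpha}}{\alpha+1}, & 0<\alpha<1,\\[1.2ex] \dfrac{\alpha}{\alpha+1}, & \alpha\ge 1.\end{cases}$$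
   Context: Notation: $[n]=\{1,\dots,n\}$. Random-order secretary problem with an $\alpha$-power signal ($\alpha>0$ a real parameter): $n$ items with distinct values arrive one by one at times $1,\dots,n$ in uniformly random order. Let $I\in[n]$ be the arrival time of the best item (so $I$ is uniform on $[n]$). After the arrival order has been fixed, a signal time $S\in[I]$ is drawn, depending on the order only through $I$, with $$\Pr[S=s\mid I=i]=\frac{s^\alpha-(s-1)^\alpha}{i^\alpha},\qquad s\in[i].$$ At each time $t$ the policy observes the relative rank of the item arriving at time $t$ among the first $t$ items, and whether the (content-free) signal occurs at time $t$, i.e. whether $S=t$; it then irrevocably decides whether to stop at time $t$ (accept that item). The policy knows $n$ and $\alpha$ and may be randomized. A policy succeeds if it stops exactly at time $I$. The success probability is taken over the arrival order, the signal, and any internal randomness; a policy is optimal if it maximizes the success probability among all policies, and the maximum is $\mathrm{OPT}_n(\alpha)$. A time (or its item) is a record if the item arriving then is the best item so far. For a (possibly random) threshold $k$, the threshold policy $\mathcal{A}(k)$ rejects all items before time $k$ and then accepts the first record from time $k$ onward (including time $k$). In particular $\mathcal{A}(\max\{S,k\})$ accepts the first record at a time $\ge\max\{S,k\}$. *)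

theory Defs
  imports "HOL-Probability.Probability" "HOL-Combinatorics.Permutations" "HOL-Library.Extended_Nat"
begin

text \<open>
  An arrival order is a permutation \<open>\<sigma>\<close> of \<open>{1..n}\<close>: \<open>\<sigma> t\<close> is the value of the item arriving at
  time \<open>t\<close>, larger values being better.
\<close>

definition best_time :: "nat \<Rightarrow> (nat \<Rightarrow> nat) \<Rightarrow> nat" where
  "best_time n \<sigma> = (THE i. i \<in> {1..n} \<and> (\<forall>j\<in>{1..n}. \<sigma> j \<le> \<sigma> i))"

lemma best_time_eqI:
  assumes "\<sigma> permutes {1..n}" "i \<in> {1..n}" "\<And>j. j \<in> {1..n} \<Longrightarrow> \<sigma> j \<le> \<sigma> i"
  shows "best_time n \<sigma> = i"
  unfolding best_time_def
proof (rule the_equality)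
  show "i \<in> {1..n} \<and> (\<forall>j\<in>{1..n}. \<sigma> j \<le> \<sigma> i)"
    using assms by blast
next
  fix i' assume "i' \<in> {1..n} \<and> (\<forall>j\<in>{1..n}. \<sigma> j \<le> \<sigma> i')"
  with assms have "\<sigma> i' = \<sigma> i" by (simp add: order_antisym)
  with permutes_inj[OF assms(1)] show "i' = i" by (simp add: inj_eq)
qed

definition is_record :: "(nat \<Rightarrow> nat) \<Rightarrow> nat \<Rightarrow> bool" where
  "is_record \<sigma> t \<longleftrightarrow> 1 \<le> t \<and> (\<forall>u\<in>{1..<t}. \<sigma> u < \<sigma> t)"

text \<open>Rank 1 is the best item so far.\<close>

definition rel_rank :: "(nat \<Rightarrow> nat) \<Rightarrow> nat \<Rightarrow> nat" where
  "rel_rank \<sigma> t = card {u \<in> {1..t}. \<sigma> t \<le> \<sigma> u}"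

text \<open>
  The conditional law of the signal time given that the best item arrives at time \<open>i \<ge> 1\<close>. As
  \<open>embed_pmf\<close> is unspecified unless its argument is a probability mass function, see
  \<open>pmf_signal_pmf\<close> below. Note \<open>0 powr \<alpha> = 0\<close>.
\<close>

definition signal_mass :: "real \<Rightarrow> nat \<Rightarrow> nat \<Rightarrow> real" where
  "signal_mass \<alpha> i s =
     (if s \<in> {1..i} then (real s powr \<alpha> - (real s - 1) powr \<alpha>) / real i powr \<alpha> else 0)"

definition signal_pmf :: "real \<Rightarrow> nat \<Rightarrow> nat pmf" where
  "signal_pmf \<alpha> i = embed_pmf (signal_mass \<alpha> i)"

lemma signal_mass_nonneg:
  assumes "\<alpha> > 0"
  shows "0 \<le> signal_mass \<alpha> i s"
  using assms by (auto simp: signal_mass_def intro!: divide_nonneg_nonneg powr_mono2)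

lemma sum_powr_diff:
  assumes "\<alpha> > 0"
  shows "(\<Sum>s=1..i. real s powr \<alpha> - (real s - 1) powr \<alpha>) = real i powr \<alpha>"
  using assms by (induction i) auto

lemma pmf_signal_pmf:
  assumes "\<alpha> > 0" "i \<ge> 1"
  shows "pmf (signal_pmf \<alpha> i) s = signal_mass \<alpha> i s"
  unfolding signal_pmf_def
proof (rule pmf_embed_pmf)
  show "0 \<le> signal_mass \<alpha> i x" for x
    using assms by (intro signal_mass_nonneg)
  have "(\<Sum>s=1..i. signal_mass \<alpha> i s)
      = (\<Sum>s=1..i. real s powr \<alpha> - (real s - 1) powr \<alpha>) / real i powr \<alpha>"
    by (simp add: signal_mass_def sum_divide_distrib)
  also have "\<dots> = 1"
    using assms sum_powr_diff[of \<alpha> i] by simp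
  finally have sum1: "(\<Sum>s=1..i. signal_mass \<alpha> i s) = 1" .
  have "(\<integral>\<^sup>+x. ennreal (signal_mass \<alpha> i x) \<partial>count_space UNIV)
      = (\<Sum>x\<in>{1..i}. ennreal (signal_mass \<alpha> i x))"
    by (intro nn_integral_count_space') (auto simp: signal_mass_def)
  also have "\<dots> = ennreal (\<Sum>x=1..i. signal_mass \<alpha> i x)"
    using assms by (intro sum_ennreal signal_mass_nonneg)
  also have "\<dots> = 1"
    by (simp only: sum1 ennreal_1)
  finally show "(\<integral>\<^sup>+x. ennreal (signal_mass \<alpha> i x) \<partial>count_space UNIV) = 1" .
qed

definition instance_pmf :: "nat \<Rightarrow> real \<Rightarrow> ((nat \<Rightarrow> nat) \<times> nat) pmf" where
  "instance_pmf n \<alpha> =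
     bind_pmf (pmf_of_set {\<sigma>. \<sigma> permutes {1..n}})
       (\<lambda>\<sigma>. map_pmf (\<lambda>s. (\<sigma>, s)) (signal_pmf \<alpha> (best_time n \<sigma>)))"

text \<open>
  The observations up to time \<open>t\<close>: for each time \<open>u \<le> t\<close>, in chronological order, the relative rank
  of the item arriving at time \<open>u\<close> and whether the signal occurs at time \<open>u\<close>. A deterministic policy
  maps such a history to the decision whether to stop; a randomized policy is a random deterministic
  policy, drawn independently of the arrival order and the signal. Since for a fixed \<open>n\<close> only
  finitely many histories can occur, discrete laws cover all internal randomization.
\<close>

type_synonym history = "(nat \<times> bool) list"
type_synonym policy = "history \<Rightarrow> bool"

definition history :: "(nat \<Rightarrow> nat) \<Rightarrow> nat \<Rightarrow> nat \<Rightarrow> history" where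
  "history \<sigma> s t = map (\<lambda>u. (rel_rank \<sigma> u, s = u)) [1..<Suc t]"

definition stops_at :: "nat \<Rightarrow> policy \<Rightarrow> (nat \<Rightarrow> nat) \<Rightarrow> nat \<Rightarrow> nat \<Rightarrow> bool" where
  "stops_at n p \<sigma> s t \<longleftrightarrow>
     t \<in> {1..n} \<and> p (history \<sigma> s t) \<and> (\<forall>u\<in>{1..<t}. \<not> p (history \<sigma> s u))"

definition success_prob :: "nat \<Rightarrow> real \<Rightarrow> policy pmf \<Rightarrow> real" where
  "success_prob n \<alpha> P =
     measure_pmf.prob (pair_pmf (instance_pmf n \<alpha>) P)
       {((\<sigma>, s), p). stops_at n p \<sigma> s (best_time n \<sigma>)}"

definition optimal :: "nat \<Rightarrow> real \<Rightarrow> policy pmf \<Rightarrow> bool" where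
  "optimal n \<alpha> P \<longleftrightarrow> (\<forall>Q. success_prob n \<alpha> Q \<le> success_prob n \<alpha> P)"

definition OPT :: "nat \<Rightarrow> real \<Rightarrow> real" where
  "OPT n \<alpha> = (SUP P. success_prob n \<alpha> P)"

text \<open>
  A random threshold is given by its value as known from the history so far, \<open>\<infinity>\<close> meaning that it
  has not been observed yet. The signal time is the first time at which the signal has been seen.
\<close>

definition signal_time :: "history \<Rightarrow> enat" where
  "signal_time h = (INF t \<in> {t. 1 \<le> t \<and> t \<le> length h \<and> snd (h ! (t - 1))}. enat t)"

definition threshold_policy :: "(history \<Rightarrow> enat) \<Rightarrow> policy" where
  "threshold_policy K h \<longleftrightarrow> h \<noteq> [] \<and> K h \<le> enat (length h) \<and> fst (last h) = 1"

lemma length_history [simp]: "length (history \<sigma> s t) = t"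
  by (simp add: history_def)

lemma signal_time_history:
  assumes "1 \<le> s"
  shows "signal_time (history \<sigma> s t) = (if s \<le> t then enat s else \<infinity>)"
proof -
  have "{u. 1 \<le> u \<and> u \<le> t \<and> snd (history \<sigma> s t ! (u - 1))} = (if s \<le> t then {s} else {})"
    using assms by (auto simp: history_def simp del: upt_Suc)
  then show ?thesis
    by (simp add: signal_time_def flip: top_enat_def)
qed

lemma rel_rank_eq_1_iff:
  assumes "1 \<le> t"
  shows "rel_rank \<sigma> t = 1 \<longleftrightarrow> is_record \<sigma> t"
proof
  have fin: "finite {u \<in> {1..t}. \<sigma> t \<le> \<sigma> u}" and t: "t \<in> {u \<in> {1..t}. \<sigma> t \<le> \<sigma> u}"
    using assms by auto
  show "is_record \<sigma> t" if "rel_rank \<sigma> t = 1"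
  proof -
    from that obtain x where x: "{u \<in> {1..t}. \<sigma> t \<le> \<sigma> u} = {x}"
      unfolding rel_rank_def by (metis card_1_singletonE)
    from t have "t \<in> {x}" by (simp only: x)
    then have "x = t" by simp
    with x have *: "u = t" if "u \<in> {1..t}" "\<sigma> t \<le> \<sigma> u" for u
      using that by blast
    have "\<sigma> u < \<sigma> t" if "u \<in> {1..<t}" for u
      using *[of u] that by (cases "\<sigma> t \<le> \<sigma> u") auto
    with assms show ?thesis by (auto simp: is_record_def)
  qed
  show "rel_rank \<sigma> t = 1" if "is_record \<sigma> t"
  proof -
    have "u = t" if "u \<in> {1..t}" "\<sigma> t \<le> \<sigma> u" for u
    proof (rule ccontr)
      assume "u \<noteq> t"
      with that have "u \<in> {1..<t}" by auto
      with \<open>is_record \<sigma> t\<close> have "\<sigma> u < \<sigma> t" by (auto simp: is_record_def)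
      with that show False by simp
    qed
    with t have "{u \<in> {1..t}. \<sigma> t \<le> \<sigma> u} = {t}" by blast
    then show ?thesis by (simp add: rel_rank_def)
  qed
qed

text \<open>The threshold policies stop where they should, seen from outside.\<close>

lemma threshold_policy_history:
  assumes "1 \<le> s" "1 \<le> t"
  shows "threshold_policy signal_time (history \<sigma> s t) \<longleftrightarrow> s \<le> t \<and> is_record \<sigma> t"
    and "threshold_policy (\<lambda>h. max (signal_time h) (enat k)) (history \<sigma> s t)
           \<longleftrightarrow> max s k \<le> t \<and> is_record \<sigma> t"
proof -
  have "last (history \<sigma> s t) = (rel_rank \<sigma> t, s = t)" "history \<sigma> s t \<noteq> []"
    using assms by (auto simp: history_def)
  then show "threshold_policy signal_time (history \<sigma> s t) \<longleftrightarrow> s \<le> t \<and> is_record \<sigma> t"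
    and "threshold_policy (\<lambda>h. max (signal_time h) (enat k)) (history \<sigma> s t)
           \<longleftrightarrow> max s k \<le> t \<and> is_record \<sigma> t"
    using assms rel_rank_eq_1_iff[of t \<sigma>]
    by (auto simp: threshold_policy_def signal_time_history)
qed

definition OPT_limit :: "real \<Rightarrow> real" where
  "OPT_limit \<alpha> =
     (if \<alpha> < 1 then (\<alpha> + (1 - \<alpha>) powr (1 + 1 / \<alpha>)) / (\<alpha> + 1) else \<alpha> / (\<alpha> + 1))"

end

theory Submission
  imports Defs "HOL-Real_Asymp.Real_Asymp"
begin

text \<open>
  Given the signal time \<open>s\<close>, success at time \<open>t \<ge> s\<close> carries the weight \<open>(s\<^sup>\<alpha> - (s - 1)\<^sup>\<alpha>) t\<^sup>-\<^sup>\<alpha>\<close>, which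
  depends on \<open>s\<close> only through a factor. Hence for each \<open>s\<close> we face the same stopping problem in the
  relative ranks: accepting a record at time \<open>t\<close> is worth \<open>t\<^sup>-\<^sup>\<alpha> t / n\<close>, waiting for the next record is
  worth \<open>D t * t / n\<close> with \<open>D t = (\<Sum>j=t+1..n. j\<^sup>-\<^sup>\<alpha> / (j - 1))\<close>. For \<open>\<alpha> \<ge> 1\<close> accepting is never worse; for
  \<open>\<alpha> < 1\<close> the difference \<open>t\<^sup>-\<^sup>\<alpha> - D t\<close> is increasing in \<open>t\<close>, which gives a threshold \<open>k\<close>. Since \<open>D t\<close>
  is close to \<open>(t\<^sup>-\<^sup>\<alpha> - n\<^sup>-\<^sup>\<alpha>) / \<alpha>\<close>, the threshold satisfies \<open>(k / n)\<^sup>\<alpha> \<longlonglongrightarrow> 1 - \<alpha>\<close>. Exchanging the sums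
  over \<open>s\<close> and \<open>j\<close>, \<open>n * OPT n \<alpha>\<close> becomes a sum over \<open>j \<in> {k..n}\<close> of terms that converge to \<open>\<alpha> / (\<alpha> + 1)\<close>,
  plus \<open>(\<Sum>s<k. s\<^sup>\<alpha>) * D (k - 1)\<close>, where \<open>k\<^sup>\<alpha> * D (k - 1)\<close> tends to 1 if \<open>\<alpha> < 1\<close>.
\<close>

subsection \<open>Relative ranks are independent and uniform\<close>

text \<open>The earlier items at least as good as the newcomer form an up-set of the common order.
  Up-sets of a total preorder are nested, so their size, the rank minus one, determines
  them.\<close>

lemma rel_rank_Suc_determines:
  assumes ord: "\<And>u v. u \<in> {1..m} \<Longrightarrow> v \<in> {1..m} \<Longrightarrow> \<sigma> u \<le> \<sigma> v \<longleftrightarrow> \<tau> u \<le> \<tau> v"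
  assumes rank: "rel_rank \<sigma> (Suc m) = rel_rank \<tau> (Suc m)"
  shows "{u \<in> {1..m}. \<sigma> (Suc m) \<le> \<sigma> u} = {u \<in> {1..m}. \<tau> (Suc m) \<le> \<tau> u}"
proof -
  let ?U = "\<lambda>\<rho>. {u \<in> {1..m}. \<rho> (Suc m) \<le> \<rho> u}"
  have "{u \<in> {1..Suc m}. \<rho> (Suc m) \<le> \<rho> u} = insert (Suc m) (?U \<rho>)" for \<rho> :: "nat \<Rightarrow> nat"
    by (auto simp: le_Suc_eq)
  then have "rel_rank \<rho> (Suc m) = Suc (card (?U \<rho>))" for \<rho>
    by (simp add: rel_rank_def)
  with rank have card: "card (?U \<sigma>) = card (?U \<tau>)" by simp
  have "?U \<sigma> \<subseteq> ?U \<tau> \<or> ?U \<tau> \<subseteq> ?U \<sigma>"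
  proof (rule ccontr)
    assume "\<not> ?thesis"
    then obtain u v where u: "u \<in> ?U \<sigma>" "u \<notin> ?U \<tau>" and v: "v \<in> ?U \<tau>" "v \<notin> ?U \<sigma>" by blast
    then have "\<sigma> v \<le> \<sigma> u" "\<not> \<tau> v \<le> \<tau> u" by auto
    with ord[of v u] u v show False by simp
  qed
  with card show ?thesis
    using card_subset_eq[of "?U \<tau>" "?U \<sigma>"] card_subset_eq[of "?U \<sigma>" "?U \<tau>"] by fastforce
qed

lemma rel_ranks_determine_order:
  assumes inj: "inj \<sigma>" "inj \<tau>"
  assumes rank: "\<And>t. t \<in> {1..m} \<Longrightarrow> rel_rank \<sigma> t = rel_rank \<tau> t"
  assumes "u \<in> {1..m}" "v \<in> {1..m}"
  shows "\<sigma> u \<le> \<sigma> v \<longleftrightarrow> \<tau> u \<le> \<tau> v"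
  using rank assms(4,5)
proof (induction m arbitrary: u v)
  case (Suc m)
  have ord: "\<sigma> u \<le> \<sigma> v \<longleftrightarrow> \<tau> u \<le> \<tau> v" if "u \<in> {1..m}" "v \<in> {1..m}" for u v
    using that by (intro Suc.IH Suc.prems(1)) auto
  have "rel_rank \<sigma> (Suc m) = rel_rank \<tau> (Suc m)" using Suc.prems(1)[of "Suc m"] by simp
  from rel_rank_Suc_determines[OF ord this]
  have new: "\<sigma> (Suc m) \<le> \<sigma> u \<longleftrightarrow> \<tau> (Suc m) \<le> \<tau> u" if "u \<in> {1..m}" for u
    using that by blast
  have new': "\<sigma> u \<le> \<sigma> (Suc m) \<longleftrightarrow> \<tau> u \<le> \<tau> (Suc m)" if "u \<in> {1..m}" for u
  proof -
    have "\<sigma> (Suc m) \<noteq> \<sigma> u" "\<tau> (Suc m) \<noteq> \<tau> u" using that inj by (auto simp: inj_eq)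
    with new[OF that] show ?thesis by linarith
  qed
  have cases: "w \<in> {1..m} \<or> w = Suc m" if "w \<in> {1..Suc m}" for w using that by auto
  from cases[OF Suc.prems(2)] cases[OF Suc.prems(3)] show ?case
    using ord new new' by auto
qed simp

text \<open>A permutation can thus be recovered from the order it induces: \<open>\<sigma>\<close>
  maps the counted positions onto \<open>{1..\<sigma> t}\<close>.\<close>

lemma permutes_eq_card_le:
  assumes "\<sigma> permutes {1..n}" "t \<in> {1..n}"
  shows "\<sigma> t = card {u \<in> {1..n}. \<sigma> u \<le> \<sigma> t}"
proof -
  have t: "\<sigma> t \<in> {1..n}" using assms by (simp only: permutes_in_image)
  have "\<sigma> ` {u \<in> {1..n}. \<sigma> u \<le> \<sigma> t} = {1..\<sigma> t}"
  proof safe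
    fix u assume "u \<in> {1..n}" "\<sigma> u \<le> \<sigma> t"
    then show "\<sigma> u \<in> {1..\<sigma> t}" using permutes_in_image[OF assms(1), of u] by simp
  next
    fix v assume v: "v \<in> {1..\<sigma> t}"
    then have "v \<in> \<sigma> ` {1..n}" using t permutes_image[OF assms(1)] by auto
    with v show "v \<in> \<sigma> ` {u \<in> {1..n}. \<sigma> u \<le> \<sigma> t}" by auto
  qed
  then have "card {1..\<sigma> t} = card {u \<in> {1..n}. \<sigma> u \<le> \<sigma> t}"
    by (metis card_image inj_on_subset permutes_inj[OF assms(1)] subset_UNIV)
  then show ?thesis by simp
qed

text \<open>
  Relative ranks \<open>(r 1, \<dots>, r n)\<close> form a Lehmer code: permutations correspond to the points of
  the product of the sets \<open>{1..t}\<close>, so uniform permutations have independent uniform relative ranks.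
\<close>

definition rank_code :: "nat \<Rightarrow> (nat \<Rightarrow> nat) \<Rightarrow> nat \<Rightarrow> nat" where
  "rank_code n \<sigma> = restrict (rel_rank \<sigma>) {1..n}"

definition rank_codes :: "nat \<Rightarrow> (nat \<Rightarrow> nat) set" where
  "rank_codes n = (\<Pi>\<^sub>E t\<in>{1..n}. {1..t})"

lemma finite_rank_codes [simp, intro]: "finite (rank_codes n)"
  unfolding rank_codes_def by (intro finite_PiE) auto

lemma card_rank_codes: "card (rank_codes n) = fact n"
  by (simp add: rank_codes_def card_PiE fact_prod)

lemma rel_rank_range:
  assumes "1 \<le> t" shows "rel_rank \<sigma> t \<in> {1..t}"
proof -
  have "rel_rank \<sigma> t \<le> card {1..t}" unfolding rel_rank_def by (intro card_mono) auto
  moreover have "card {t} \<le> rel_rank \<sigma> t"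
    unfolding rel_rank_def using assms by (intro card_mono) auto
  ultimately show ?thesis by simp
qed

text \<open>Injective because the ranks determine the order and the order determines the
  permutation; surjective because both sides have \<open>fact n\<close> elements, so no decoding map
  has to be built.\<close>

lemma bij_betw_rank_code:
  "bij_betw (rank_code n) {\<sigma>. \<sigma> permutes {1..n}} (rank_codes n)"
proof -
  have inj: "inj_on (rank_code n) {\<sigma>. \<sigma> permutes {1..n}}"
  proof (rule inj_onI, safe)
    fix \<sigma> \<tau> assume p: "\<sigma> permutes {1..n}" "\<tau> permutes {1..n}" and eq: "rank_code n \<sigma> = rank_code n \<tau>"
    have rank: "rel_rank \<sigma> t = rel_rank \<tau> t" if "t \<in> {1..n}" for t
      using fun_cong[OF eq, of t] that by (simp add: rank_code_def)
    note ord = rel_ranks_determine_order[OF permutes_inj[OF p(1)] permutes_inj[OF p(2)] rank]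
    show "\<sigma> = \<tau>"
    proof
      fix t show "\<sigma> t = \<tau> t"
      proof (cases "t \<in> {1..n}")
        case True
        have "{u \<in> {1..n}. \<sigma> u \<le> \<sigma> t} = {u \<in> {1..n}. \<tau> u \<le> \<tau> t}"
          using ord True by blast
        with permutes_eq_card_le[OF p(1) True] permutes_eq_card_le[OF p(2) True]
        show ?thesis by simp
      next
        case False
        then show ?thesis using p by (simp add: permutes_not_in)
      qed
    qed
  qed
  have sub: "rank_code n ` {\<sigma>. \<sigma> permutes {1..n}} \<subseteq> rank_codes n"
    using rel_rank_range by (auto simp: rank_code_def rank_codes_def)
  have "card (rank_code n ` {\<sigma>. \<sigma> permutes {1..n}}) = card (rank_codes n)"
    using inj by (simp add: card_image card_permutations[OF refl] card_rank_codes)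
  with inj sub show ?thesis by (simp add: bij_betw_def card_subset_eq)
qed

section \<open>The best item as the last record\<close>

lemma
  assumes "\<sigma> permutes {1..n}" "n \<ge> 1"
  shows best_time_in_range: "best_time n \<sigma> \<in> {1..n}"
    and best_time_max: "j \<in> {1..n} \<Longrightarrow> \<sigma> j \<le> \<sigma> (best_time n \<sigma>)"
proof -
  have "Max (\<sigma> ` {1..n}) \<in> \<sigma> ` {1..n}" using assms(2) by (intro Max_in) auto
  then obtain i where i: "i \<in> {1..n}" "\<sigma> i = Max (\<sigma> ` {1..n})" by auto
  then have "best_time n \<sigma> = i" by (intro best_time_eqI[OF assms(1)]) auto
  with i show "best_time n \<sigma> \<in> {1..n}" "j \<in> {1..n} \<Longrightarrow> \<sigma> j \<le> \<sigma> (best_time n \<sigma>)"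
    by simp_all
qed

text \<open>The maximum is a record after which no record follows; of two times with this property,
  the later would be a record that the earlier one forbids.\<close>

lemma best_time_eq_iff_last_record:
  assumes "\<sigma> permutes {1..n}" "t \<in> {1..n}"
  shows "best_time n \<sigma> = t \<longleftrightarrow> is_record \<sigma> t \<and> (\<forall>u\<in>{t<..n}. \<not> is_record \<sigma> u)"
proof -
  let ?M = "\<lambda>i. i \<in> {1..n} \<and> (\<forall>j\<in>{1..n}. \<sigma> j \<le> \<sigma> i)"
  have inj: "\<sigma> u = \<sigma> v \<longleftrightarrow> u = v" for u v using permutes_inj[OF assms(1)] by (simp add: inj_eq)
  have M: "is_record \<sigma> i \<and> (\<forall>u\<in>{i<..n}. \<not> is_record \<sigma> u)" if "?M i" for i
  proof -
    have lt: "\<sigma> u < \<sigma> i" if "u \<in> {1..n}" "u \<noteq> i" for u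
      using that \<open>?M i\<close> inj[of u i] by (simp add: order.strict_iff_order)
    have "is_record \<sigma> i" using that by (auto simp: is_record_def intro: lt)
    moreover have "\<not> is_record \<sigma> u" if "u \<in> {i<..n}" for u
    proof
      assume "is_record \<sigma> u"
      with that \<open>?M i\<close> have "\<sigma> i < \<sigma> u" by (auto simp: is_record_def)
      with that lt[of u] \<open>?M i\<close> show False by simp
    qed
    ultimately show ?thesis by blast
  qed
  have i: "?M (best_time n \<sigma>)"
    using best_time_in_range[OF assms(1)] best_time_max[OF assms(1)] assms(2) by simp
  have "t = best_time n \<sigma>" if "is_record \<sigma> t" "\<forall>u\<in>{t<..n}. \<not> is_record \<sigma> u"
  proof (rule ccontr)
    assume "t \<noteq> best_time n \<sigma>"
    then consider "t < best_time n \<sigma>" | "best_time n \<sigma> < t" by linarith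
    then show False
    proof cases
      case 1
      then have "best_time n \<sigma> \<in> {t<..n}" using i by simp
      with that(2) M[OF i] show False by blast
    next
      case 2
      then have "t \<in> {best_time n \<sigma><..n}" using assms(2) by simp
      with that(1) M[OF i] show False by blast
    qed
  qed
  moreover have "is_record \<sigma> t \<and> (\<forall>u\<in>{t<..n}. \<not> is_record \<sigma> u)" if "t = best_time n \<sigma>"
    using M[OF i] that by simp
  ultimately show ?thesis by blast
qed

section \<open>Events depending on given ranks, and the uniform measure on rank codes\<close>

definition adapted :: "nat set \<Rightarrow> ((nat \<Rightarrow> nat) \<Rightarrow> bool) \<Rightarrow> bool" where
  "adapted T A \<longleftrightarrow> (\<forall>r r'. (\<forall>u\<in>T. r u = r' u) \<longrightarrow> A r = A r')"

definition code_prob :: "nat \<Rightarrow> ((nat \<Rightarrow> nat) \<Rightarrow> bool) \<Rightarrow> real" where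
  "code_prob n A = real (card {r \<in> rank_codes n. A r}) / fact n"

lemma code_prob_nonneg [simp]: "0 \<le> code_prob n A"
  by (simp add: code_prob_def)

lemma code_prob_mono:
  assumes "\<And>r. r \<in> rank_codes n \<Longrightarrow> A r \<Longrightarrow> B r"
  shows "code_prob n A \<le> code_prob n B"
  unfolding code_prob_def using assms
  by (intro divide_right_mono of_nat_mono card_mono) auto

lemma code_prob_True: "code_prob n (\<lambda>_. True) = 1"
  by (simp add: code_prob_def card_rank_codes)

lemma code_prob_split:
  "code_prob n A = code_prob n (\<lambda>r. A r \<and> B r) + code_prob n (\<lambda>r. A r \<and> \<not> B r)"
proof -
  have "{r \<in> rank_codes n. A r}
      = {r \<in> rank_codes n. A r \<and> B r} \<union> {r \<in> rank_codes n. A r \<and> \<not> B r}" by auto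
  also have "card \<dots> = card {r \<in> rank_codes n. A r \<and> B r} + card {r \<in> rank_codes n. A r \<and> \<not> B r}"
    by (intro card_Un_disjoint) auto
  finally show ?thesis by (simp add: code_prob_def add_divide_distrib)
qed

text \<open>Rank \<open>t\<close> is uniform on \<open>{1..t}\<close> and independent of the earlier
  ranks: overwriting it does not affect \<open>A\<close>, so each code with \<open>r t = 1\<close>
  stands for the \<open>t\<close> codes that agree with it away from \<open>t\<close>.\<close>

lemma code_prob_record:
  assumes "adapted {1..<t} A" "t \<in> {1..n}"
  shows "code_prob n (\<lambda>r. A r \<and> r t = 1) = code_prob n A / real t"
proof -
  have A: "A (r(t := j)) = A r" for r j
    by (rule assms(1)[unfolded adapted_def, rule_format]) simp
  have upd: "r(t := j) \<in> rank_codes n" if "r \<in> rank_codes n" "j \<in> {1..t}" for r j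
    using that assms(2) unfolding rank_codes_def PiE_def extensional_def by (auto simp: Pi_iff)
  have "bij_betw (\<lambda>(r, j). r(t := j)) ({r \<in> rank_codes n. A r \<and> r t = 1} \<times> {1..t})
      {r \<in> rank_codes n. A r}"
  proof (rule bij_betw_byWitness[where f' = "\<lambda>r. (r(t := 1), r t)"])
    show "\<forall>a\<in>{r \<in> rank_codes n. A r \<and> r t = 1} \<times> {1..t}.
        (\<lambda>r. (r(t := 1), r t)) ((\<lambda>(r, j). r(t := j)) a) = a" by auto
    show "(\<lambda>(r, j). r(t := j)) ` ({r \<in> rank_codes n. A r \<and> r t = 1} \<times> {1..t})
        \<subseteq> {r \<in> rank_codes n. A r}"
    proof (rule image_subsetI)
      fix x assume x: "x \<in> {r \<in> rank_codes n. A r \<and> r t = 1} \<times> {1..t}"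
      obtain r j where "x = (r, j)" by fastforce
      with x show "(\<lambda>(r, j). r(t := j)) x \<in> {r \<in> rank_codes n. A r}"
        using upd[of r j] A[of r j] by simp
    qed
    show "(\<lambda>r. (r(t := 1), r t)) ` {r \<in> rank_codes n. A r}
        \<subseteq> {r \<in> rank_codes n. A r \<and> r t = 1} \<times> {1..t}"
    proof (rule image_subsetI)
      fix r assume "r \<in> {r \<in> rank_codes n. A r}"
      then have r: "r \<in> rank_codes n" "A r" by auto
      have "r t \<in> {1..t}" using r(1) assms(2) by (auto simp: rank_codes_def PiE_def Pi_iff)
      with r show "(r(t := 1), r t) \<in> {r \<in> rank_codes n. A r \<and> r t = 1} \<times> {1..t}"
        using upd[of r 1] A[of r 1] assms(2) by simp
    qed
  qed auto
  from bij_betw_same_card[OF this]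
  have "card {r \<in> rank_codes n. A r \<and> r t = 1} * t = card {r \<in> rank_codes n. A r}"
    by (simp add: card_cartesian_product)
  then have "real (card {r \<in> rank_codes n. A r}) = real (card {r \<in> rank_codes n. A r \<and> r t = 1}) * real t"
    by (simp only: flip: of_nat_mult)
  then show ?thesis using assms(2) by (simp add: code_prob_def)
qed

text \<open>The later times fail to be records independently, with probability
  \<open>1 - 1 / u\<close> at time \<open>u\<close>; the product over \<open>t < u \<le> n\<close>
  telescopes to \<open>t / n\<close>. The induction extends the window one time at a time.\<close>

lemma code_prob_last_record:
  assumes "adapted {1..t} A" "t \<in> {1..n}"
  shows "code_prob n (\<lambda>r. A r \<and> r t = 1 \<and> (\<forall>u\<in>{t<..n}. r u \<noteq> 1))
    = code_prob n (\<lambda>r. A r \<and> r t = 1) * real t / real n"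
proof -
  have "m \<le> n \<longrightarrow> code_prob n (\<lambda>r. A r \<and> r t = 1 \<and> (\<forall>u\<in>{t<..m}. r u \<noteq> 1))
    = code_prob n (\<lambda>r. A r \<and> r t = 1) * real t / real m" if "m \<ge> t" for m
    using that
  proof (induction m rule: dec_induct)
    case base
    then show ?case using assms(2) by simp
  next
    case (step m)
    show ?case
    proof
      assume le: "Suc m \<le> n"
      let ?B = "\<lambda>r. A r \<and> r t = 1 \<and> (\<forall>u\<in>{t<..m}. r u \<noteq> 1)"
      have iff: "(A r \<and> r t = 1 \<and> (\<forall>u\<in>{t<..Suc m}. r u \<noteq> 1)) \<longleftrightarrow> ?B r \<and> r (Suc m) \<noteq> 1" for r
        using step.hyps by (auto simp: le_Suc_eq)
      have "adapted {1..<Suc m} ?B"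
        unfolding adapted_def
      proof (intro allI impI)
        fix r r' :: "nat \<Rightarrow> nat" assume eq: "\<forall>u\<in>{1..<Suc m}. r u = r' u"
        then have "\<forall>u\<in>{1..t}. r u = r' u" using step.hyps by auto
        with assms(1) have "A r = A r'" unfolding adapted_def by blast
        moreover have "r t = r' t" using eq step.hyps assms(2) by auto
        moreover have "\<forall>u\<in>{t<..m}. r u = r' u" using eq by auto
        ultimately show "?B r = ?B r'" by auto
      qed
      from code_prob_record[OF this, of n] le
      have rec: "code_prob n (\<lambda>r. ?B r \<and> r (Suc m) = 1) = code_prob n ?B / real (Suc m)"
        by simp
      have "code_prob n (\<lambda>r. ?B r \<and> r (Suc m) \<noteq> 1) = code_prob n ?B - code_prob n ?B / real (Suc m)"
        using code_prob_split[of n ?B "\<lambda>r. r (Suc m) = 1"] rec by linarith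
      also have "\<dots> = code_prob n ?B * real m / real (Suc m)"
        by (simp add: field_simps)
      also have "\<dots> = code_prob n (\<lambda>r. A r \<and> r t = 1) * real t / real (Suc m)"
        using step.IH le step.hyps assms(2) by (simp add: field_simps)
      finally show "code_prob n (\<lambda>r. A r \<and> r t = 1 \<and> (\<forall>u\<in>{t<..Suc m}. r u \<noteq> 1))
        = code_prob n (\<lambda>r. A r \<and> r t = 1) * real t / real (Suc m)"
        by (simp only: iff)
    qed
  qed
  from this[of n] assms(2) show ?thesis by simp
qed

subsection \<open>Stopping with a reward for the best item\<close>

text \<open>The expected reward of the stopping rule \<open>d\<close> if stopping at the time
  \<open>t\<close> of the best item pays \<open>f t\<close>: the last two conjuncts say that
  \<open>t\<close> is the last record.\<close>

definition stop_value :: "nat \<Rightarrow> (nat \<Rightarrow> real) \<Rightarrow> (nat \<Rightarrow> (nat \<Rightarrow> nat) \<Rightarrow> bool) \<Rightarrow> real" where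
  "stop_value n f d = (\<Sum>t=1..n. f t * code_prob n
     (\<lambda>r. ((\<forall>u\<in>{1..<t}. \<not> d u r) \<and> d t r) \<and> r t = 1 \<and> (\<forall>u\<in>{t<..n}. r u \<noteq> 1)))"

lemma adapted_alive:
  assumes "\<And>t. t \<in> {1..n} \<Longrightarrow> adapted {1..t} (d t)" "t \<le> n"
  shows "adapted {1..t} (\<lambda>r. \<forall>u\<in>{1..t}. \<not> d u r)"
  unfolding adapted_def
proof (intro allI impI)
  fix r r' :: "nat \<Rightarrow> nat" assume eq: "\<forall>u\<in>{1..t}. r u = r' u"
  have "d u r = d u r'" if "u \<in> {1..t}" for u
  proof -
    have "adapted {1..u} (d u)" using assms that by simp
    then show ?thesis using eq that unfolding adapted_def by simp
  qed
  then show "(\<forall>u\<in>{1..t}. \<not> d u r) = (\<forall>u\<in>{1..t}. \<not> d u r')" by blast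
qed

lemma adapted_stop:
  assumes "\<And>t. t \<in> {1..n} \<Longrightarrow> adapted {1..t} (d t)" "t \<in> {1..n}"
  shows "adapted {1..t} (\<lambda>r. (\<forall>u\<in>{1..<t}. \<not> d u r) \<and> d t r)"
proof -
  have "adapted {1..t - 1} (\<lambda>r. \<forall>u\<in>{1..t - 1}. \<not> d u r)" "adapted {1..t} (d t)"
    using adapted_alive[of n d "t - 1"] assms by auto
  moreover have "{1..t - 1} = {1..<t}" using assms(2) by auto
  ultimately have al: "adapted {1..<t} (\<lambda>r. \<forall>u\<in>{1..<t}. \<not> d u r)" and dt: "adapted {1..t} (d t)"
    by simp_all
  show ?thesis unfolding adapted_def
  proof (intro allI impI arg_cong2[where f = "(\<and>)"])
    fix r r' :: "nat \<Rightarrow> nat" assume eq: "\<forall>u\<in>{1..t}. r u = r' u"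
    then show "d t r = d t r'" using dt by (simp add: adapted_def)
    show "(\<forall>u\<in>{1..<t}. \<not> d u r) = (\<forall>u\<in>{1..<t}. \<not> d u r')"
      using eq by (intro al[unfolded adapted_def, rule_format]) simp
  qed
qed

lemma stop_value_eq:
  assumes "\<And>t. t \<in> {1..n} \<Longrightarrow> adapted {1..t} (d t)"
  shows "stop_value n f d = (\<Sum>t=1..n. f t * (real t / real n) *
    code_prob n (\<lambda>r. ((\<forall>u\<in>{1..<t}. \<not> d u r) \<and> d t r) \<and> r t = 1))"
  unfolding stop_value_def
proof (intro sum.cong refl)
  fix t assume t: "t \<in> {1..n}"
  show "f t * code_prob n
         (\<lambda>r. ((\<forall>u\<in>{1..<t}. \<not> d u r) \<and> d t r) \<and> r t = 1 \<and> (\<forall>u\<in>{t<..n}. r u \<noteq> 1)) =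
    f t * (real t / real n) * code_prob n (\<lambda>r. ((\<forall>u\<in>{1..<t}. \<not> d u r) \<and> d t r) \<and> r t = 1)"
    by (subst code_prob_last_record[OF adapted_stop[OF assms t] t]) auto
qed

text \<open>\<open>x\<close> is the probability of not having stopped before time \<open>t\<close>,
  \<open>z\<close> that of stopping at \<open>t\<close>, and \<open>y\<close> that of stopping there
  on a record. A record at \<open>t\<close> is independent of the past, hence the bound
  \<open>x / real t\<close> on \<open>y\<close>.\<close>

lemma alive_Suc:
  assumes "\<And>t. t \<in> {1..n} \<Longrightarrow> adapted {1..t} (d t)" "t \<in> {1..n}"
  defines "x \<equiv> code_prob n (\<lambda>r. \<forall>u\<in>{1..<t}. \<not> d u r)"
    and "y \<equiv> code_prob n (\<lambda>r. ((\<forall>u\<in>{1..<t}. \<not> d u r) \<and> d t r) \<and> r t = 1)"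
    and "z \<equiv> code_prob n (\<lambda>r. (\<forall>u\<in>{1..<t}. \<not> d u r) \<and> d t r)"
  shows "code_prob n (\<lambda>r. \<forall>u\<in>{1..<Suc t}. \<not> d u r) = x - z"
    and "y \<le> z" and "y \<le> x / real t"
    and "code_prob n (\<lambda>r. (\<forall>u\<in>{1..<t}. \<not> d u r) \<and> r t = 1) = x / real t"
proof -
  have "(\<forall>u\<in>{1..<Suc t}. \<not> d u r) \<longleftrightarrow> (\<forall>u\<in>{1..<t}. \<not> d u r) \<and> \<not> d t r" for r
    using assms(2) by (auto simp: less_Suc_eq)
  then show "code_prob n (\<lambda>r. \<forall>u\<in>{1..<Suc t}. \<not> d u r) = x - z"
    unfolding x_def z_def using code_prob_split[of n "\<lambda>r. \<forall>u\<in>{1..<t}. \<not> d u r" "d t"] by simp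
  show "y \<le> z" unfolding y_def z_def by (intro code_prob_mono) auto
  have "{1..t - 1} = {1..<t}" using assms(2) by auto
  then have "adapted {1..<t} (\<lambda>r. \<forall>u\<in>{1..<t}. \<not> d u r)"
    using adapted_alive[of n d "t - 1"] assms(1,2) by auto
  from code_prob_record[OF this assms(2)]
  show rec: "code_prob n (\<lambda>r. (\<forall>u\<in>{1..<t}. \<not> d u r) \<and> r t = 1) = x / real t"
    by (simp add: x_def)
  show "y \<le> x / real t" unfolding y_def rec[symmetric] by (intro code_prob_mono) auto
qed

text \<open>
  \<open>W t\<close> bounds the value of continuing after time \<open>t\<close>. The proof shows that the reward collected
  up to time \<open>t\<close> plus \<open>W t\<close> on the event of not having stopped has nonincreasing expectation.
\<close>

lemma stop_value_le:
  assumes adapted: "\<And>t. t \<in> {1..n} \<Longrightarrow> adapted {1..t} (d t)"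
    and W0: "\<And>t. 0 \<le> W t"
    and W: "\<And>t. t \<in> {1..n} \<Longrightarrow> W t + max 0 (f t * (real t / real n) - W t) / real t \<le> W (t - 1)"
  shows "stop_value n f d \<le> W 0"
proof -
  let ?y = "\<lambda>t. code_prob n (\<lambda>r. ((\<forall>u\<in>{1..<t}. \<not> d u r) \<and> d t r) \<and> r t = 1)"
  let ?x = "\<lambda>t. code_prob n (\<lambda>r. \<forall>u\<in>{1..<Suc t}. \<not> d u r)"
  have "(\<Sum>t=1..m. f t * (real t / real n) * ?y t) + W m * ?x m \<le> W 0" if "m \<le> n" for m
    using that
  proof (induction m)
    case 0
    then show ?case by (simp add: code_prob_True)
  next
    case (Suc m)
    let ?t = "Suc m"
    have t: "?t \<in> {1..n}" using Suc.prems by simp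
    define G where "G = f ?t * (real ?t / real n)"
    define z where "z = code_prob n (\<lambda>r. (\<forall>u\<in>{1..<?t}. \<not> d u r) \<and> d ?t r)"
    have x: "?x ?t = ?x m - z" and y: "?y ?t \<le> z" "?y ?t \<le> ?x m / real ?t"
      unfolding z_def using alive_Suc(1-3)[OF adapted t] by blast+
    have y0: "0 \<le> ?y ?t" by simp
    have "G * ?y ?t + W ?t * ?x ?t = W ?t * ?x m + (G * ?y ?t - W ?t * z)"
      unfolding x by algebra
    \<comment> \<open>Stopping on a non-record gains nothing and forfeits \<open>W ?t\<close>, which
      is nonnegative.\<close>
    also have "\<dots> \<le> W ?t * ?x m + (G - W ?t) * ?y ?t"
      using mult_left_mono[OF y(1) W0[of ?t]] by (simp add: algebra_simps)
    also have "\<dots> \<le> W ?t * ?x m + max 0 (G - W ?t) * ?y ?t"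
      using y0 by (intro add_left_mono mult_right_mono) auto
    also have "\<dots> \<le> W ?t * ?x m + max 0 (G - W ?t) * (?x m / real ?t)"
      using y(2) by (intro add_left_mono mult_left_mono) auto
    also have "\<dots> = (W ?t + max 0 (G - W ?t) / real ?t) * ?x m"
      by (simp add: algebra_simps)
    also have "\<dots> \<le> W m * ?x m"
      using W[OF t] by (intro mult_right_mono) (auto simp: G_def)
    finally have "G * ?y ?t + W ?t * ?x ?t \<le> W m * ?x m" .
    moreover have "(\<Sum>t=1..?t. f t * (real t / real n) * ?y t)
        = (\<Sum>t=1..m. f t * (real t / real n) * ?y t) + G * ?y ?t"
      by (simp add: G_def)
    ultimately show ?case using Suc.IH Suc.prems by linarith
  qed
  from this[of n] have "(\<Sum>t=1..n. f t * (real t / real n) * ?y t) + W n * ?x n \<le> W 0" by simp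
  moreover have "0 \<le> W n * ?x n" using W0[of n] by simp
  ultimately show ?thesis using stop_value_eq[of n d f, OF adapted] by linarith
qed

text \<open>The equality case of \<open>stop_value_le\<close>: this rule stops on records only, so
  nothing is forfeited, and it accepts any record it meets from \<open>m\<close> on.\<close>

lemma stop_value_threshold:
  assumes d: "\<And>t r. t \<in> {1..n} \<Longrightarrow> d t r \<longleftrightarrow> m \<le> t \<and> r t = 1"
    and Wn: "W n = 0"
    and W: "\<And>t. t \<in> {1..n} \<Longrightarrow>
      W (t - 1) = W t + (if m \<le> t then (f t * (real t / real n) - W t) / real t else 0)"
  shows "stop_value n f d = W 0"
proof -
  have adapted: "adapted {1..t} (d t)" if "t \<in> {1..n}" for t
    using d[OF that] that by (auto simp: adapted_def)
  let ?y = "\<lambda>t. code_prob n (\<lambda>r. ((\<forall>u\<in>{1..<t}. \<not> d u r) \<and> d t r) \<and> r t = 1)"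
  let ?x = "\<lambda>t. code_prob n (\<lambda>r. \<forall>u\<in>{1..<Suc t}. \<not> d u r)"
  have "(\<Sum>t=1..i. f t * (real t / real n) * ?y t) + W i * ?x i = W 0" if "i \<le> n" for i
    using that
  proof (induction i)
    case 0
    then show ?case by (simp add: code_prob_True)
  next
    case (Suc j)
    let ?t = "Suc j"
    have t: "?t \<in> {1..n}" using Suc.prems by simp
    define G where "G = f ?t * (real ?t / real n)"
    define z where "z = code_prob n (\<lambda>r. (\<forall>u\<in>{1..<?t}. \<not> d u r) \<and> d ?t r)"
    have x: "?x ?t = ?x j - z"
      unfolding z_def using alive_Suc(1)[OF adapted t] by blast
    have zy: "z = ?y ?t" unfolding z_def d[OF t] by (intro arg_cong[where f = "code_prob n"] ext) auto
    have y: "?y ?t = (if m \<le> ?t then ?x j / real ?t else 0)"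
    proof (cases "m \<le> ?t")
      case True
      then have "?y ?t = code_prob n (\<lambda>r. (\<forall>u\<in>{1..<?t}. \<not> d u r) \<and> r ?t = 1)"
        unfolding d[OF t] by (intro arg_cong[where f = "code_prob n"] ext) auto
      also have "\<dots> = ?x j / real ?t" using alive_Suc(4)[OF adapted t] by blast
      finally show ?thesis using True by simp
    next
      case False
      then show ?thesis unfolding d[OF t] by (simp add: code_prob_def)
    qed
    have "G * ?y ?t + W ?t * ?x ?t = W ?t * ?x j + (G - W ?t) * ?y ?t"
      unfolding x zy by algebra
    also have "\<dots> = (W ?t + (if m \<le> ?t then (G - W ?t) / real ?t else 0)) * ?x j"
      unfolding y by (simp add: algebra_simps diff_divide_distrib)
    also have "\<dots> = W j * ?x j"
      using W[OF t] by (simp add: G_def)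
    finally have "G * ?y ?t + W ?t * ?x ?t = W j * ?x j" .
    moreover have "(\<Sum>t=1..?t. f t * (real t / real n) * ?y t)
        = (\<Sum>t=1..j. f t * (real t / real n) * ?y t) + G * ?y ?t"
      by (simp add: G_def)
    ultimately show ?case using Suc.IH Suc.prems by linarith
  qed
  from this[of n] show ?thesis using stop_value_eq[of n d f, OF adapted] Wn by simp
qed

subsection \<open>Success probabilities of policies\<close>

definition code_history :: "(nat \<Rightarrow> nat) \<Rightarrow> nat \<Rightarrow> nat \<Rightarrow> history" where
  "code_history r s t = map (\<lambda>u. (r u, s = u)) [1..<Suc t]"

lemma code_history_rank_code:
  assumes "t \<le> n" shows "code_history (rank_code n \<sigma>) s t = history \<sigma> s t"
  using assms by (simp add: code_history_def history_def rank_code_def del: upt_Suc)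

lemma adapted_code_history: "adapted {1..t} (\<lambda>r. p (code_history r s t))"
proof -
  have "code_history r s t = code_history r' s t" if "\<forall>u\<in>{1..t}. r u = r' u" for r r'
    using that by (simp add: code_history_def del: upt_Suc)
  then show ?thesis unfolding adapted_def by metis
qed

text \<open>The numerator of \<open>signal_mass\<close>. Together with \<open>reward\<close> it
  separates the mass into a factor in \<open>s\<close> and a factor in \<open>t\<close>, where
  \<open>s\<close> survives only in the cut-off \<open>s \<le> t\<close>.\<close>

definition signal_increment :: "real \<Rightarrow> nat \<Rightarrow> real" where
  "signal_increment \<alpha> s = real s powr \<alpha> - (real s - 1) powr \<alpha>"

definition reward :: "real \<Rightarrow> nat \<Rightarrow> nat \<Rightarrow> real" where
  "reward \<alpha> s t = (if s \<le> t then real t powr - \<alpha> else 0)"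

text \<open>Counting is transferred along the bijection \<open>rank_code\<close>: being the best
  time is a condition on the records, and for fixed \<open>s\<close> the policy sees nothing but
  ranks.\<close>

lemma card_stops_at_best_time:
  assumes "t \<in> {1..n}"
  shows "card {\<sigma>. \<sigma> permutes {1..n} \<and> best_time n \<sigma> = t \<and> stops_at n p \<sigma> s t}
    = card {r \<in> rank_codes n. ((\<forall>u\<in>{1..<t}. \<not> p (code_history r s u)) \<and> p (code_history r s t))
        \<and> r t = 1 \<and> (\<forall>u\<in>{t<..n}. r u \<noteq> 1)}" (is "card ?S = card {r \<in> _. ?A r}")
proof -
  have iff: "best_time n \<sigma> = t \<and> stops_at n p \<sigma> s t \<longleftrightarrow> ?A (rank_code n \<sigma>)"
    if "\<sigma> permutes {1..n}" for \<sigma>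
  proof -
    have rec: "is_record \<sigma> u \<longleftrightarrow> rank_code n \<sigma> u = 1" if "u \<in> {1..n}" for u
      using that rel_rank_eq_1_iff[of u \<sigma>] by (simp add: rank_code_def)
    have "best_time n \<sigma> = t \<longleftrightarrow> rank_code n \<sigma> t = 1 \<and> (\<forall>u\<in>{t<..n}. rank_code n \<sigma> u \<noteq> 1)"
      using best_time_eq_iff_last_record[OF that assms] rec assms by auto
    moreover have "stops_at n p \<sigma> s t \<longleftrightarrow>
      (\<forall>u\<in>{1..<t}. \<not> p (code_history (rank_code n \<sigma>) s u)) \<and> p (code_history (rank_code n \<sigma>) s t)"
      using assms by (auto simp: stops_at_def code_history_rank_code)
    ultimately show ?thesis by blast
  qed
  have "?S = {\<sigma> \<in> {\<sigma>. \<sigma> permutes {1..n}}. ?A (rank_code n \<sigma>)}"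
    using iff by blast
  then have "rank_code n ` ?S = {r \<in> rank_code n ` {\<sigma>. \<sigma> permutes {1..n}}. ?A r}"
    by (simp only: Compr_image_eq[where P = ?A])
  also have "rank_code n ` {\<sigma>. \<sigma> permutes {1..n}} = rank_codes n"
    by (rule bij_betw_imp_surj_on[OF bij_betw_rank_code])
  finally have image: "rank_code n ` ?S = {r \<in> rank_codes n. ?A r}" .
  have inj: "inj_on (rank_code n) ?S"
    using bij_betw_imp_inj_on[OF bij_betw_rank_code, of n] by (rule inj_on_subset) auto
  show ?thesis using card_image[OF inj] unfolding image by (rule sym)
qed

text \<open>
  For a fixed signal time \<open>s\<close> a deterministic policy is a stopping rule in the relative ranks,
  so the success probability splits into independent problems, one for each \<open>s\<close>.
\<close>

definition det_success :: "nat \<Rightarrow> real \<Rightarrow> policy \<Rightarrow> real" where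
  "det_success n \<alpha> p = (\<Sum>s=1..n. signal_increment \<alpha> s *
     stop_value n (reward \<alpha> s) (\<lambda>t r. p (code_history r s t)))"

section \<open>From randomized policies to \<open>det_success\<close>\<close>

lemma measure_bind_pmf:
  "measure_pmf.prob (bind_pmf M f) X = (\<integral>x. measure_pmf.prob (f x) X \<partial>M)"
proof -
  have "ennreal (measure_pmf.prob (bind_pmf M f) X) = (\<integral>\<^sup>+x. ennreal (measure_pmf.prob (f x) X) \<partial>M)"
    by (simp flip: measure_pmf.emeasure_eq_measure)
  also have "\<dots> = ennreal (\<integral>x. measure_pmf.prob (f x) X \<partial>M)"
    by (intro nn_integral_eq_integral measure_pmf.integrable_const_bound[where B = 1]) auto
  finally show ?thesis by (simp add: integral_nonneg_AE)
qed

lemma prob_instance_stops: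
  assumes "\<alpha> > 0" "n \<ge> 1"
  shows "measure_pmf.prob (instance_pmf n \<alpha>) {(\<sigma>, s). stops_at n p \<sigma> s (best_time n \<sigma>)}
    = det_success n \<alpha> p"
proof -
  let ?P = "{\<sigma>. \<sigma> permutes {1..n}}"
  let ?I = "best_time n"
  let ?E = "{(\<sigma>, s). stops_at n p \<sigma> s (best_time n \<sigma>)}"
  have fin: "finite ?P" by (simp add: finite_permutations)
  have "id \<in> ?P" by (simp add: permutes_id)
  then have ne: "?P \<noteq> {}" by blast
  let ?f = "\<lambda>\<sigma> s. signal_mass \<alpha> (?I \<sigma>) s * of_bool (stops_at n p \<sigma> s (?I \<sigma>))"
  have inner: "measure_pmf.prob (map_pmf (Pair \<sigma>) (signal_pmf \<alpha> (?I \<sigma>))) ?E = (\<Sum>s=1..n. ?f \<sigma> s)"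
    if "\<sigma> \<in> ?P" for \<sigma>
  proof -
    have I: "?I \<sigma> \<in> {1..n}" using best_time_in_range assms that by auto
    have "measure_pmf.prob (map_pmf (Pair \<sigma>) (signal_pmf \<alpha> (?I \<sigma>))) ?E
        = measure_pmf.prob (signal_pmf \<alpha> (?I \<sigma>)) {s. stops_at n p \<sigma> s (?I \<sigma>)}"
      by (simp add: vimage_def)
    also have "\<dots> = (\<integral>s. indicator {s. stops_at n p \<sigma> s (?I \<sigma>)} s \<partial>signal_pmf \<alpha> (?I \<sigma>))"
      by simp
    also have "\<dots> = (\<Sum>s=1..n. indicator {s. stops_at n p \<sigma> s (?I \<sigma>)} s * pmf (signal_pmf \<alpha> (?I \<sigma>)) s)"
      using I assms by (intro integral_measure_pmf_real)
        (auto simp: set_pmf_eq pmf_signal_pmf signal_mass_def split: if_splits)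
    also have "\<dots> = (\<Sum>s=1..n. ?f \<sigma> s)"
      using I assms by (intro sum.cong) (auto simp: pmf_signal_pmf)
    finally show ?thesis .
  qed
  have prob: "measure_pmf.prob (instance_pmf n \<alpha>) ?E
      = (\<Sum>\<sigma>\<in>?P. \<Sum>s=1..n. ?f \<sigma> s) / fact n"
    using fin ne inner
    by (simp add: instance_pmf_def measure_bind_pmf integral_pmf_of_set card_permutations[OF refl])
  \<comment> \<open>The best time becomes a summation variable, so that permutations can be counted
    for each of its values.\<close>
  have "(\<Sum>\<sigma>\<in>?P. \<Sum>s=1..n. ?f \<sigma> s)
      = (\<Sum>\<sigma>\<in>?P. \<Sum>s=1..n. \<Sum>t=1..n. signal_mass \<alpha> t s * of_bool (?I \<sigma> = t \<and> stops_at n p \<sigma> s t))"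
  proof (intro sum.cong refl)
    fix \<sigma> s assume "\<sigma> \<in> ?P"
    then have I: "?I \<sigma> \<in> {1..n}" using best_time_in_range assms by auto
    have "(\<Sum>t=1..n. signal_mass \<alpha> t s * of_bool (?I \<sigma> = t \<and> stops_at n p \<sigma> s t))
        = (\<Sum>t=1..n. if t = ?I \<sigma> then ?f \<sigma> s else 0)"
      by (intro sum.cong) auto
    with I show "?f \<sigma> s = (\<Sum>t=1..n. signal_mass \<alpha> t s * of_bool (?I \<sigma> = t \<and> stops_at n p \<sigma> s t))"
      by simp
  qed
  also have "\<dots> = (\<Sum>s=1..n. \<Sum>t=1..n. \<Sum>\<sigma>\<in>?P.
      signal_mass \<alpha> t s * of_bool (?I \<sigma> = t \<and> stops_at n p \<sigma> s t))"
    by (subst sum.swap, intro sum.cong refl, rule sum.swap)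
  finally have swap: "(\<Sum>\<sigma>\<in>?P. \<Sum>s=1..n. ?f \<sigma> s) = (\<Sum>s=1..n. \<Sum>t=1..n. \<Sum>\<sigma>\<in>?P.
      signal_mass \<alpha> t s * of_bool (?I \<sigma> = t \<and> stops_at n p \<sigma> s t))" .
  have "(\<Sum>s=1..n. \<Sum>t=1..n. \<Sum>\<sigma>\<in>?P. signal_mass \<alpha> t s * of_bool (?I \<sigma> = t \<and> stops_at n p \<sigma> s t))
      = fact n * det_success n \<alpha> p"
    unfolding det_success_def stop_value_def sum_distrib_left
  proof (intro sum.cong refl)
    fix s t assume s: "s \<in> {1..n}" and t: "t \<in> {1..n}"
    let ?A = "\<lambda>r. ((\<forall>u\<in>{1..<t}. \<not> p (code_history r s u)) \<and> p (code_history r s t))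
        \<and> r t = 1 \<and> (\<forall>u\<in>{t<..n}. r u \<noteq> 1)"
    have count: "(\<Sum>\<sigma>\<in>?P. of_bool (?I \<sigma> = t \<and> stops_at n p \<sigma> s t) :: real)
        = real (card {\<sigma>. \<sigma> permutes {1..n} \<and> ?I \<sigma> = t \<and> stops_at n p \<sigma> s t})"
      using fin by (simp add: Collect_conj_eq sum.If_cases of_bool_def)
    have m: "signal_mass \<alpha> t s = signal_increment \<alpha> s * reward \<alpha> s t"
      using s t by (simp add: signal_mass_def signal_increment_def reward_def powr_minus_divide)
    show "(\<Sum>\<sigma>\<in>?P. signal_mass \<alpha> t s * of_bool (?I \<sigma> = t \<and> stops_at n p \<sigma> s t))
      = fact n * (signal_increment \<alpha> s * (reward \<alpha> s t * code_prob n ?A))"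
      unfolding sum_distrib_left[symmetric] count card_stops_at_best_time[OF t] m code_prob_def
      by simp
  qed
  then show ?thesis unfolding prob swap by simp
qed

lemma success_prob_eq_expectation:
  assumes "\<alpha> > 0" "n \<ge> 1"
  shows "success_prob n \<alpha> P = measure_pmf.expectation P (det_success n \<alpha>)"
proof -
  let ?E = "{((\<sigma>, s), p). stops_at n p \<sigma> s (best_time n \<sigma>)}"
  \<comment> \<open>By independence the policy may be drawn first.\<close>
  have "pair_pmf (instance_pmf n \<alpha>) P = bind_pmf P (\<lambda>p. map_pmf (\<lambda>x. (x, p)) (instance_pmf n \<alpha>))"
    by (subst pair_commute_pmf) (simp add: pair_pmf_def map_pmf_def bind_assoc_pmf bind_return_pmf)
  then have prob: "success_prob n \<alpha> P
      = (\<integral>p. measure_pmf.prob (map_pmf (\<lambda>x. (x, p)) (instance_pmf n \<alpha>)) ?E \<partial>P)"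
    unfolding success_prob_def by (simp add: measure_bind_pmf)
  have det: "(\<lambda>p. measure_pmf.prob (map_pmf (\<lambda>x. (x, p)) (instance_pmf n \<alpha>)) ?E) = det_success n \<alpha>"
    by (simp add: fun_eq_iff measure_map_pmf vimage_def case_prod_unfold
        flip: prob_instance_stops[OF assms])
  show ?thesis unfolding prob det ..
qed

text \<open>A randomized policy scores an average of deterministic values, so comparison with
  deterministic policies suffices and the supremum is attained at \<open>p\<close>.\<close>

lemma optimal_return_pmfI:
  assumes "\<alpha> > 0" "n \<ge> 1" and best: "\<And>q. det_success n \<alpha> q \<le> det_success n \<alpha> p"
  shows "optimal n \<alpha> (return_pmf p)" and "OPT n \<alpha> = det_success n \<alpha> p"
proof -
  have det: "0 \<le> det_success n \<alpha> q \<and> det_success n \<alpha> q \<le> 1" for q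
    by (simp flip: prob_instance_stops[OF assms(1,2)])
  have p: "success_prob n \<alpha> (return_pmf p) = det_success n \<alpha> p"
    by (simp add: success_prob_eq_expectation[OF assms(1,2)])
  have le: "success_prob n \<alpha> Q \<le> det_success n \<alpha> p" for Q
    unfolding success_prob_eq_expectation[OF assms(1,2)]
    using best det by (intro measure_pmf.integral_le_const measure_pmf.integrable_const_bound[where B = 1]) auto
  with p show "optimal n \<alpha> (return_pmf p)" by (simp add: optimal_def)
  show "OPT n \<alpha> = det_success n \<alpha> p"
    unfolding OPT_def using le p by (intro cSup_eq_maximum) (auto intro: image_eqI[of _ _ "return_pmf p"])
qed

subsection \<open>Estimates for power sums\<close>

text \<open>
  After time \<open>t \<ge> 1\<close>, the first later record falls on \<open>j\<close> with probability \<open>t / (j * (j - 1))\<close>, and it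
  is the best item with probability \<open>j / n\<close>; so accepting it has value \<open>t / n * record_tail \<alpha> n t\<close>.
\<close>

definition record_tail :: "real \<Rightarrow> nat \<Rightarrow> nat \<Rightarrow> real" where
  "record_tail \<alpha> n t = (\<Sum>j=Suc t..n. real j powr - \<alpha> / (real j - 1))"

lemma record_tail_nonneg: "0 \<le> record_tail \<alpha> n t"
  unfolding record_tail_def by (intro sum_nonneg) auto

lemma record_tail_self [simp]: "record_tail \<alpha> n n = 0"
  by (simp add: record_tail_def)

lemma record_tail_step:
  assumes "t < n"
  shows "record_tail \<alpha> n t = record_tail \<alpha> n (Suc t) + real (Suc t) powr - \<alpha> / real t"
  using assms by (simp add: record_tail_def sum.atLeast_Suc_atMost[of "Suc t" n])

text \<open>Prepares the comparison with \<open>record_tail_step\<close>: if tail and power agree at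
  \<open>t + 1\<close>, then at \<open>t\<close> the tail is \<open>1 + 1 / t\<close> times the old
  power, and the power is \<open>(1 + 1 / t) powr \<alpha>\<close> times it. Whether
  \<open>\<alpha>\<close> is above or below 1 decides which is larger.\<close>

lemma powr_uminus_step:
  assumes "t \<ge> 1"
  shows "real t powr - \<alpha> = (1 + 1 / real t) powr \<alpha> * real (Suc t) powr - \<alpha>"
proof -
  have "1 + 1 / real t = real (Suc t) / real t" using assms by (simp add: field_simps)
  then show ?thesis using assms by (simp add: powr_divide powr_minus field_simps)
qed

lemma record_tail_le_ge_1:
  assumes "\<alpha> \<ge> 1" "1 \<le> t" "t \<le> n"
  shows "record_tail \<alpha> n t \<le> real t powr - \<alpha>"
  using assms(3,2)
proof (induction t rule: inc_induct)
  case base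
  then show ?case by simp
next
  case (step t)
  have "1 + 1 / real t \<le> (1 + 1 / real t) powr \<alpha>"
    using assms(1) powr_mono[of 1 \<alpha> "1 + 1 / real t"] by simp
  then have "(1 + 1 / real t) * real (Suc t) powr - \<alpha> \<le> real t powr - \<alpha>"
    unfolding powr_uminus_step[OF step.prems] by (intro mult_right_mono) auto
  then show ?case using step.IH step.hyps by (simp add: record_tail_step field_simps)
qed

text \<open>From \<open>u\<close> to \<open>u + 1\<close> the tail loses
  \<open>(u + 1) powr - \<alpha> / u\<close>, and for \<open>\<alpha> \<le> 1\<close> the power
  loses at most as much. Thus once accepting is worthwhile, it stays so.\<close>

lemma record_tail_le_mono:
  assumes "\<alpha> \<le> 1" "1 \<le> t" "t \<le> u" "u \<le> n" "record_tail \<alpha> n t \<le> real t powr - \<alpha>"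
  shows "record_tail \<alpha> n u \<le> real u powr - \<alpha>"
  using assms(3,4)
proof (induction u rule: dec_induct)
  case base
  show ?case by (rule assms(5))
next
  case (step u)
  have u: "1 \<le> u" using assms(2) step.hyps by simp
  have "(1 + 1 / real u) powr \<alpha> \<le> 1 + 1 / real u"
    using assms(1) powr_mono[of \<alpha> 1 "1 + 1 / real u"] by simp
  then have "real u powr - \<alpha> \<le> (1 + 1 / real u) * real (Suc u) powr - \<alpha>"
    unfolding powr_uminus_step[OF u] by (intro mult_right_mono) auto
  then show ?case using step by (simp add: record_tail_step field_simps)
qed

section \<open>Comparing the tail with integrals\<close>

lemma powr_mean_value:
  fixes x y p :: real
  assumes "0 < x" "x < y"
  obtains z where "x < z" "z < y" "y powr p - x powr p = (y - x) * (p * z powr (p - 1))"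
proof -
  have "\<exists>z. x < z \<and> z < y \<and> y powr p - x powr p = (y - x) * (p * z powr (p - 1))"
  proof (rule MVT2[OF assms(2)])
    fix z assume "x \<le> z"
    then show "((\<lambda>z. z powr p) has_real_derivative p * z powr (p - 1)) (at z)"
      using assms(1) by (intro has_real_derivative_powr) simp
  qed
  then show ?thesis using that by blast
qed

text \<open>The summand at \<open>j\<close> is at least the integral of
  \<open>x powr (- \<alpha> - 1)\<close> over \<open>[j, j + 1]\<close>; the mean value theorem
  stands in for the integral.\<close>

lemma record_tail_lower:
  assumes "\<alpha> > 0" "1 \<le> t" "t \<le> n"
  shows "real (Suc t) powr - \<alpha> - real (Suc n) powr - \<alpha> \<le> \<alpha> * record_tail \<alpha> n t"
  using assms(3,2)
proof (induction t rule: inc_induct)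
  case base
  then show ?case by simp
next
  case (step t)
  obtain z where z: "real (Suc t) < z" and eq: "real (Suc (Suc t)) powr - \<alpha> - real (Suc t) powr - \<alpha>
      = (real (Suc (Suc t)) - real (Suc t)) * (- \<alpha> * z powr (- \<alpha> - 1))"
    by (rule powr_mean_value[of "real (Suc t)" "real (Suc (Suc t))" "- \<alpha>"]) auto
  have "z powr (- \<alpha> - 1) \<le> real (Suc t) powr (- \<alpha> - 1)"
    using z assms(1) by (intro powr_mono2') auto
  also have "\<dots> = real (Suc t) powr - \<alpha> / real (Suc t)"
    by (simp add: powr_diff)
  also have "\<dots> \<le> real (Suc t) powr - \<alpha> / real t"
    using step.prems by (intro divide_left_mono) auto
  finally have "\<alpha> * z powr (- \<alpha> - 1) \<le> \<alpha> * (real (Suc t) powr - \<alpha> / real t)"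
    using assms(1) by (intro mult_left_mono) auto
  moreover have "\<alpha> * record_tail \<alpha> n t
      = \<alpha> * record_tail \<alpha> n (Suc t) + \<alpha> * (real (Suc t) powr - \<alpha> / real t)"
    using step.hyps by (simp add: record_tail_step distrib_left)
  ultimately show ?case using step.IH eq by simp
qed

text \<open>The summand at \<open>j\<close> is at most the same integral over
  \<open>[j - 2, j - 1]\<close>, which reaches down to \<open>t - 1\<close>; hence
  \<open>2 \<le> t\<close>.\<close>

lemma record_tail_upper:
  assumes "\<alpha> > 0" "2 \<le> t" "t \<le> n"
  shows "\<alpha> * record_tail \<alpha> n t \<le> (real t - 1) powr - \<alpha> - (real n - 1) powr - \<alpha>"
  using assms(3,2)
proof (induction t rule: inc_induct)
  case base
  then show ?case by simp
next
  case (step t)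
  obtain z where z: "real t - 1 < z" "z < real t" and eq: "real t powr - \<alpha> - (real t - 1) powr - \<alpha>
      = (real t - (real t - 1)) * (- \<alpha> * z powr (- \<alpha> - 1))"
    by (rule powr_mean_value[of "real t - 1" "real t" "- \<alpha>"]) (use step.prems in auto)
  have "real (Suc t) powr - \<alpha> / real t \<le> real t powr - \<alpha> / real t"
    using step.prems assms(1) by (intro divide_right_mono powr_mono2') auto
  also have "\<dots> = real t powr (- \<alpha> - 1)"
    by (simp add: powr_diff)
  also have "\<dots> \<le> z powr (- \<alpha> - 1)"
    using z step.prems assms(1) by (intro powr_mono2') auto
  finally have "\<alpha> * (real (Suc t) powr - \<alpha> / real t) \<le> \<alpha> * z powr (- \<alpha> - 1)"
    using assms(1) by (intro mult_left_mono) auto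
  moreover have "\<alpha> * record_tail \<alpha> n t
      = \<alpha> * record_tail \<alpha> n (Suc t) + \<alpha> * (real (Suc t) powr - \<alpha> / real t)"
    using step.hyps by (simp add: record_tail_step distrib_left)
  ultimately show ?case using step.IH step.prems eq by simp
qed

text \<open>If accepting at \<open>t\<close> is no worse than waiting,
  \<open>record_tail_lower\<close> bounds \<open>t\<close> below in terms of \<open>n\<close>;
  multiplying by \<open>t powr \<alpha>\<close> leaves only ratios.\<close>

lemma threshold_ratio_lower:
  assumes "\<alpha> > 0" "1 \<le> t" "t \<le> n" "record_tail \<alpha> n t \<le> real t powr - \<alpha>"
  shows "(real t / (real t + 1)) powr \<alpha> - \<alpha> \<le> (real t / (real n + 1)) powr \<alpha>"
proof -
  have "real (Suc t) powr - \<alpha> - real (Suc n) powr - \<alpha> \<le> \<alpha> * real t powr - \<alpha>"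
    using record_tail_lower[OF assms(1-3)] mult_left_mono[OF assms(4), of \<alpha>] assms(1) by linarith
  from mult_left_mono[OF this, of "real t powr \<alpha>"]
  have "real t powr \<alpha> * real (Suc t) powr - \<alpha> - real t powr \<alpha> * real (Suc n) powr - \<alpha>
      \<le> \<alpha> * (real t powr \<alpha> * real t powr - \<alpha>)"
    by (simp add: algebra_simps)
  then show ?thesis using assms(2)
    by (simp add: powr_divide powr_minus_divide add.commute)
qed

text \<open>The counterpart where waiting is no worse, from
  \<open>record_tail_upper\<close>.\<close>

lemma threshold_ratio_upper:
  assumes "\<alpha> > 0" "2 \<le> t" "t \<le> n" "real t powr - \<alpha> \<le> record_tail \<alpha> n t"
  shows "(real t / (real n - 1)) powr \<alpha> \<le> (real t / (real t - 1)) powr \<alpha> - \<alpha>"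
proof -
  have "\<alpha> * real t powr - \<alpha> \<le> (real t - 1) powr - \<alpha> - (real n - 1) powr - \<alpha>"
    using record_tail_upper[OF assms(1-3)] mult_left_mono[OF assms(4), of \<alpha>] assms(1) by linarith
  from mult_left_mono[OF this, of "real t powr \<alpha>"]
  have "\<alpha> * (real t powr \<alpha> * real t powr - \<alpha>)
      \<le> real t powr \<alpha> * (real t - 1) powr - \<alpha> - real t powr \<alpha> * (real n - 1) powr - \<alpha>"
    by (simp add: algebra_simps)
  then show ?thesis using assms(2,3)
    by (simp add: powr_divide powr_minus_divide add.commute)
qed

definition power_sum :: "real \<Rightarrow> nat \<Rightarrow> real" where
  "power_sum \<alpha> j = (\<Sum>s=1..<j. real s powr \<alpha>)"

lemma powr_Suc_diff_bounds:
  assumes "\<alpha> > 0"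
  shows "(\<alpha> + 1) * real s powr \<alpha> \<le> real (Suc s) powr (\<alpha> + 1) - real s powr (\<alpha> + 1)"
    and "real (Suc s) powr (\<alpha> + 1) - real s powr (\<alpha> + 1) \<le> (\<alpha> + 1) * real (Suc s) powr \<alpha>"
proof -
  have "(\<alpha> + 1) * real s powr \<alpha> \<le> real (Suc s) powr (\<alpha> + 1) - real s powr (\<alpha> + 1)
    \<and> real (Suc s) powr (\<alpha> + 1) - real s powr (\<alpha> + 1) \<le> (\<alpha> + 1) * real (Suc s) powr \<alpha>"
  proof (cases "s = 0")
    \<comment> \<open>\<open>powr_mean_value\<close> requires a positive left end, so
      \<open>s = 0\<close> is split off.\<close>
    case False
    then obtain z where z: "real s < z" "z < real (Suc s)"
      and eq: "real (Suc s) powr (\<alpha> + 1) - real s powr (\<alpha> + 1)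
        = (real (Suc s) - real s) * ((\<alpha> + 1) * z powr (\<alpha> + 1 - 1))"
      by (elim powr_mean_value[of "real s" "real (Suc s)" "\<alpha> + 1", rotated 2]) auto
    have "real s powr \<alpha> \<le> z powr \<alpha>" "z powr \<alpha> \<le> real (Suc s) powr \<alpha>"
      using z assms by (auto intro!: powr_mono2)
    then show ?thesis unfolding eq using assms by simp
  qed (use assms in simp)
  then show "(\<alpha> + 1) * real s powr \<alpha> \<le> real (Suc s) powr (\<alpha> + 1) - real s powr (\<alpha> + 1)"
    and "real (Suc s) powr (\<alpha> + 1) - real s powr (\<alpha> + 1) \<le> (\<alpha> + 1) * real (Suc s) powr \<alpha>"
    by blast+
qed

lemma power_sum_Suc: "power_sum \<alpha> (Suc j) = power_sum \<alpha> j + real j powr \<alpha>"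
  by (cases "j = 0") (simp_all add: power_sum_def)

lemma power_sum_bounds:
  assumes "\<alpha> > 0"
  shows "(\<alpha> + 1) * power_sum \<alpha> j \<le> real j powr (\<alpha> + 1)"
    and "real j powr (\<alpha> + 1) \<le> (\<alpha> + 1) * (power_sum \<alpha> j + real j powr \<alpha>)"
proof -
  show "(\<alpha> + 1) * power_sum \<alpha> j \<le> real j powr (\<alpha> + 1)"
  proof (induction j)
    case (Suc j)
    then show ?case using powr_Suc_diff_bounds(1)[OF assms, of j]
      unfolding power_sum_Suc distrib_left by linarith
  qed (simp add: power_sum_def)
  show "real j powr (\<alpha> + 1) \<le> (\<alpha> + 1) * (power_sum \<alpha> j + real j powr \<alpha>)"
  proof (induction j)
    case (Suc j)
    then show ?case using powr_Suc_diff_bounds(2)[OF assms, of j]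
      unfolding power_sum_Suc distrib_left by linarith
  qed (simp add: power_sum_def)
qed

lemma power_sum_asymp:
  assumes "\<alpha> > 0"
  shows "(\<lambda>j. power_sum \<alpha> j / real j powr (\<alpha> + 1)) \<longlonglongrightarrow> 1 / (\<alpha> + 1)"
proof (rule tendsto_sandwich)
  show "\<forall>\<^sub>F j in sequentially. power_sum \<alpha> j / real j powr (\<alpha> + 1) \<le> 1 / (\<alpha> + 1)"
    using eventually_gt_at_top[of 0]
  proof eventually_elim
    case (elim j)
    then show ?case using power_sum_bounds(1)[OF assms, of j] assms by (simp add: field_simps)
  qed
  show "\<forall>\<^sub>F j in sequentially. 1 / (\<alpha> + 1) - 1 / real j \<le> power_sum \<alpha> j / real j powr (\<alpha> + 1)"
    using eventually_gt_at_top[of 0]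
  proof eventually_elim
    case (elim j)
    have "1 / (\<alpha> + 1) \<le> (power_sum \<alpha> j + real j powr \<alpha>) / real j powr (\<alpha> + 1)"
      using power_sum_bounds(2)[OF assms, of j] assms elim by (simp add: divide_simps mult.commute)
    moreover have "real j powr \<alpha> / real j powr (\<alpha> + 1) = 1 / real j"
      using elim by (simp add: powr_add)
    then have "(power_sum \<alpha> j + real j powr \<alpha>) / real j powr (\<alpha> + 1)
        = power_sum \<alpha> j / real j powr (\<alpha> + 1) + 1 / real j"
      by (simp add: add_divide_distrib)
    ultimately show ?case by simp
  qed
  show "(\<lambda>j. 1 / (\<alpha> + 1) - 1 / real j) \<longlonglongrightarrow> 1 / (\<alpha> + 1)"
    by real_asymp
qed simp

lemma tendsto_cesaro_mean:
  fixes f :: "nat \<Rightarrow> real"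
  assumes "f \<longlonglongrightarrow> L"
  shows "(\<lambda>n. (\<Sum>j=1..n. f j) / real n) \<longlonglongrightarrow> L"
proof (rule LIMSEQ_I)
  fix e :: real assume "e > 0"
  then obtain N where N: "\<bar>f j - L\<bar> < e / 2" if "j \<ge> N" for j
    using LIMSEQ_D[OF assms, of "e / 2"] by auto
  define C where "C = (\<Sum>j=1..N. \<bar>f j - L\<bar>)"
  have bound: "(\<Sum>j=1..n. \<bar>f j - L\<bar>) \<le> C + real n * (e / 2)" for n
  proof -
    \<comment> \<open>Every index pays \<open>e / 2\<close>; only those up to \<open>N\<close> also
      pay their own deviation, in total at most \<open>C\<close>.\<close>
    have "(\<Sum>j=1..n. \<bar>f j - L\<bar>) \<le> (\<Sum>j=1..n. (if j \<le> N then \<bar>f j - L\<bar> else 0) + e / 2)"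
      using N \<open>e > 0\<close> by (intro sum_mono) (auto simp: less_imp_le)
    also have "\<dots> = (\<Sum>j\<in>{1..n} \<inter> {..N}. \<bar>f j - L\<bar>) + real n * (e / 2)"
      by (subst sum.inter_restrict) (simp_all add: sum.distrib)
    also have "\<dots> \<le> C + real n * (e / 2)"
      unfolding C_def by (intro add_right_mono sum_mono2) auto
    finally show ?thesis .
  qed
  have "(\<lambda>n. C / real n) \<longlonglongrightarrow> 0" by real_asymp
  then obtain M where M: "\<bar>C / real n\<bar> < e / 2" if "n \<ge> M" for n
    using LIMSEQ_D[of "\<lambda>n. C / real n" 0 "e / 2"] \<open>e > 0\<close> by auto
  show "\<exists>no. \<forall>n\<ge>no. norm ((\<Sum>j=1..n. f j) / real n - L) < e"
  proof (intro exI[of _ "Suc M"] allI impI)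
    fix n assume n: "n \<ge> Suc M"
    have "(\<Sum>j=1..n. f j) / real n - L = (\<Sum>j=1..n. f j - L) / real n"
      using n by (simp add: sum_subtractf field_simps)
    also have "norm \<dots> \<le> (\<Sum>j=1..n. \<bar>f j - L\<bar>) / real n"
      by (simp add: divide_right_mono sum_abs)
    also have "\<dots> \<le> (C + real n * (e / 2)) / real n"
      using bound by (intro divide_right_mono) auto
    also have "\<dots> = C / real n + e / 2" using n by (simp add: field_simps)
    also have "\<dots> < e" using M[OF Suc_leD[OF n]] by linarith
    finally show "norm ((\<Sum>j=1..n. f j) / real n - L) < e" .
  qed
qed

subsection \<open>Optimality of threshold policies\<close>

lemma signal_time_code_history:
  assumes "1 \<le> s"
  shows "signal_time (code_history r s t) = (if s \<le> t then enat s else \<infinity>)"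
proof -
  have "{u. 1 \<le> u \<and> u \<le> length (code_history r s t) \<and> snd (code_history r s t ! (u - 1))}
      = (if s \<le> t then {s} else {})"
    using assms by (auto simp: code_history_def simp del: upt_Suc)
  then show ?thesis by (simp add: signal_time_def flip: top_enat_def)
qed

lemma threshold_policy_code_history:
  assumes "1 \<le> s" "1 \<le> t"
  shows "threshold_policy signal_time (code_history r s t) \<longleftrightarrow> s \<le> t \<and> r t = 1"
    and "threshold_policy (\<lambda>h. max (signal_time h) (enat k)) (code_history r s t)
      \<longleftrightarrow> max s k \<le> t \<and> r t = 1"
proof -
  have "last (code_history r s t) = (r t, s = t)" "code_history r s t \<noteq> []"
    "length (code_history r s t) = t"
    using assms by (auto simp: code_history_def)
  then show "threshold_policy signal_time (code_history r s t) \<longleftrightarrow> s \<le> t \<and> r t = 1"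
    and "threshold_policy (\<lambda>h. max (signal_time h) (enat k)) (code_history r s t)
      \<longleftrightarrow> max s k \<le> t \<and> r t = 1"
    using assms by (auto simp: threshold_policy_def signal_time_code_history)
qed

text \<open>
  The value of waiting for the first record from time \<open>m\<close> on. Time 1 is always a record, and there the
  formula for \<open>m > 1\<close> would lose the summand with the vanishing denominator.
\<close>

definition first_record_value :: "real \<Rightarrow> nat \<Rightarrow> nat \<Rightarrow> real" where
  "first_record_value \<alpha> n m =
     (if m = 1 then 1 / real n else (real m - 1) / real n * record_tail \<alpha> n (m - 1))"

lemma first_record_value_Suc:
  assumes "t \<ge> 1"
  shows "first_record_value \<alpha> n (Suc t) = real t / real n * record_tail \<alpha> n t"
  using assms by (simp add: first_record_value_def)

lemma first_record_value_nonneg: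
  assumes "m \<ge> 1" shows "0 \<le> first_record_value \<alpha> n m"
  using assms by (simp add: first_record_value_def record_tail_nonneg)

text \<open>One step of dynamic programming: time \<open>t\<close> is a record with probability
  \<open>1 / t\<close>, and then accepting replaces waiting. At \<open>t = 1\<close> this is certain
  and the later value cancels.\<close>

lemma first_record_value_step:
  assumes "t \<in> {1..n}"
  shows "first_record_value \<alpha> n t = first_record_value \<alpha> n (Suc t)
    + (real t powr - \<alpha> * (real t / real n) - first_record_value \<alpha> n (Suc t)) / real t"
proof (cases "t = 1")
  case True
  then show ?thesis by (simp add: first_record_value_def)
next
  case False
  with assms obtain u where u: "t = Suc u" "1 \<le> u" "u < n" by (cases t) auto
  have *: "(x - 1) / N * (D + c / (x - 1)) = x / N * D + (c * (x / N) - x / N * D) / x"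
    if "x > 1" "N > 0" for x N D c :: real
    using that by (simp add: field_simps)
  have "first_record_value \<alpha> n t
      = (real t - 1) / real n * (record_tail \<alpha> n t + real t powr - \<alpha> / (real t - 1))"
    using u by (simp add: first_record_value_def record_tail_step)
  also have "\<dots> = real t / real n * record_tail \<alpha> n t
      + (real t powr - \<alpha> * (real t / real n) - real t / real n * record_tail \<alpha> n t) / real t"
    using u by (intro *) auto
  finally show ?thesis using assms by (simp add: first_record_value_Suc)
qed

text \<open>Weak inequalities on both sides leave ties free. The condition on \<open>1 < k\<close>
  supplies the monotonicity of \<open>t powr (1 - \<alpha>)\<close> used before the threshold, and
  is vacuous for \<open>k = 1\<close>, so one notion serves all \<open>\<alpha>\<close>.\<close>

definition is_threshold :: "real \<Rightarrow> nat \<Rightarrow> nat \<Rightarrow> bool" where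
  "is_threshold \<alpha> n k \<longleftrightarrow> k \<in> {1..n} \<and> (1 < k \<longrightarrow> \<alpha> \<le> 1) \<and>
     (\<forall>t\<in>{k..n}. record_tail \<alpha> n t \<le> real t powr - \<alpha>) \<and>
     (\<forall>t\<in>{1..<k}. real t powr - \<alpha> \<le> record_tail \<alpha> n t)"

text \<open>Before the signal the reward is zero. Otherwise \<open>t < k\<close>, and accepting is
  worth \<open>t powr (1 - \<alpha>) / n\<close>, which is nondecreasing in \<open>t\<close>, so it
  is at most the value at \<open>k - 1\<close>, where waiting is no worse.\<close>

lemma reward_le_first_record_value:
  assumes "is_threshold \<alpha> n k" "t < max s k" "t \<in> {1..n}" "1 \<le> s"
  shows "reward \<alpha> s t * (real t / real n) \<le> first_record_value \<alpha> n (max s k)"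
proof (cases "s \<le> t")
  case False
  then show ?thesis using assms(4) by (simp add: reward_def first_record_value_nonneg)
next
  case True
  with assms(2) have tk: "t < k" and max: "max s k = k" by auto
  obtain u where u: "k = Suc u" "t \<le> u" using tk by (cases k) auto
  have "\<alpha> \<le> 1" using assms(1,3) tk by (auto simp: is_threshold_def)
  have n: "real n > 0" using assms(3) by simp
  have "real t powr - \<alpha> * real t = real t powr (1 - \<alpha>)"
    using assms(3) by (simp add: powr_diff powr_minus_divide)
  also have "\<dots> \<le> real u powr (1 - \<alpha>)"
    using \<open>\<alpha> \<le> 1\<close> u by (intro powr_mono2) auto
  also have "\<dots> = real u * real u powr - \<alpha>"
    using assms(3) u by (simp add: powr_diff powr_minus_divide)
  also have "\<dots> \<le> real u * record_tail \<alpha> n u"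
    using assms(1,3) u by (intro mult_left_mono) (auto simp: is_threshold_def)
  finally have "real t powr - \<alpha> * real t / real n \<le> real u * record_tail \<alpha> n u / real n"
    using n by (intro divide_right_mono) auto
  then show ?thesis using True u assms(3) unfolding max by (simp add: reward_def first_record_value_Suc)
qed

definition threshold_value :: "real \<Rightarrow> nat \<Rightarrow> nat \<Rightarrow> real" where
  "threshold_value \<alpha> n k =
     (\<Sum>s=1..n. signal_increment \<alpha> s * first_record_value \<alpha> n (max s k))"

lemma signal_increment_nonneg:
  assumes "\<alpha> > 0" "1 \<le> s" shows "0 \<le> signal_increment \<alpha> s"
  using assms by (auto simp: signal_increment_def intro!: powr_mono2)

text \<open>The bound is shown for each \<open>s\<close> separately, hence even against a rule that
  knows \<open>s\<close> in advance. From \<open>max s k\<close> on, accepting is no worse and the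
  recursion required by \<open>stop_value_le\<close> holds with equality; earlier, accepting gains
  nothing.\<close>

lemma det_success_le_threshold_value:
  assumes "\<alpha> > 0" "is_threshold \<alpha> n k"
  shows "det_success n \<alpha> p \<le> threshold_value \<alpha> n k"
  unfolding det_success_def threshold_value_def
proof (intro sum_mono mult_left_mono)
  fix s assume s: "s \<in> {1..n}"
  define W where "W t = first_record_value \<alpha> n (max (Suc t) (max s k))" for t
  have "stop_value n (reward \<alpha> s) (\<lambda>t r. p (code_history r s t)) \<le> W 0"
  proof (rule stop_value_le)
    show "adapted {1..t} (\<lambda>r. p (code_history r s t))" for t by (rule adapted_code_history)
    show "0 \<le> W t" for t unfolding W_def by (intro first_record_value_nonneg) simp
    fix t assume t: "t \<in> {1..n}"
    show "W t + max 0 (reward \<alpha> s t * (real t / real n) - W t) / real t \<le> W (t - 1)"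
    proof (cases "max s k \<le> t")
      case True
      then have W: "W t = first_record_value \<alpha> n (Suc t)" "W (t - 1) = first_record_value \<alpha> n t"
        and r: "reward \<alpha> s t = real t powr - \<alpha>"
        using t by (auto simp: W_def reward_def max.absorb1)
      have "W t = real t / real n * record_tail \<alpha> n t"
        unfolding W using t by (simp add: first_record_value_Suc)
      also have "\<dots> \<le> real t / real n * real t powr - \<alpha>"
        using assms(2) True t by (intro mult_left_mono) (auto simp: is_threshold_def)
      finally have "max 0 (reward \<alpha> s t * (real t / real n) - W t)
          = real t powr - \<alpha> * (real t / real n) - first_record_value \<alpha> n (Suc t)"
        unfolding r W by (simp add: mult.commute)
      then show ?thesis unfolding W using first_record_value_step[OF t, of \<alpha>] by simp
    next
      case False
      then have W: "W t = first_record_value \<alpha> n (max s k)" "W (t - 1) = W t"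
        using t by (auto simp: W_def max_def)
      have "max 0 (reward \<alpha> s t * (real t / real n) - W t) = 0"
        unfolding W using reward_le_first_record_value[OF assms(2) _ t, of s] False s by simp
      then show ?thesis using W by simp
    qed
  qed
  also have "W 0 = first_record_value \<alpha> n (max s k)" using s by (simp add: W_def max_def)
  finally show "stop_value n (reward \<alpha> s) (\<lambda>t r. p (code_history r s t))
    \<le> first_record_value \<alpha> n (max s k)" .
qed (use assms in \<open>auto intro: signal_increment_nonneg\<close>)

text \<open>The hypothesis on \<open>p\<close> covers both policies, since
  \<open>max s 1 = s\<close> for signal times.\<close>

lemma det_success_threshold_policy:
  assumes k: "k \<in> {1..n}"
    and p: "\<And>r s t. 1 \<le> s \<Longrightarrow> 1 \<le> t \<Longrightarrow> p (code_history r s t) \<longleftrightarrow> max s k \<le> t \<and> r t = 1"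
  shows "det_success n \<alpha> p = threshold_value \<alpha> n k"
  unfolding det_success_def threshold_value_def
proof (intro sum.cong refl arg_cong2[where f = "(*)"])
  fix s assume s: "s \<in> {1..n}"
  define W where "W t = first_record_value \<alpha> n (max (Suc t) (max s k))" for t
  have "stop_value n (reward \<alpha> s) (\<lambda>t r. p (code_history r s t)) = W 0"
  proof (rule stop_value_threshold)
    show "p (code_history r s t) \<longleftrightarrow> max s k \<le> t \<and> r t = 1" if "t \<in> {1..n}" for t r
      using p[of s t r] s that by simp
    show "W n = 0" using s k by (simp add: W_def max_def first_record_value_Suc)
    fix t assume t: "t \<in> {1..n}"
    show "W (t - 1) = W t +
      (if max s k \<le> t then (reward \<alpha> s t * (real t / real n) - W t) / real t else 0)"
    proof (cases "max s k \<le> t")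
      case True
      then have W: "W t = first_record_value \<alpha> n (Suc t)" "W (t - 1) = first_record_value \<alpha> n t"
        and r: "reward \<alpha> s t = real t powr - \<alpha>"
        using t by (auto simp: W_def reward_def max.absorb1)
      show ?thesis unfolding W r using first_record_value_step[OF t, of \<alpha>] True by simp
    next
      case False
      then show ?thesis using t by (auto simp: W_def max_def)
    qed
  qed
  also have "W 0 = first_record_value \<alpha> n (max s k)" using s by (simp add: W_def max_def)
  finally show "stop_value n (reward \<alpha> s) (\<lambda>t r. p (code_history r s t))
    = first_record_value \<alpha> n (max s k)" .
qed

lemma optimal_threshold_policy:
  assumes "\<alpha> > 0" "is_threshold \<alpha> n k"
  shows "optimal n \<alpha> (return_pmf (threshold_policy (\<lambda>h. max (signal_time h) (enat k))))"
    and "OPT n \<alpha> = threshold_value \<alpha> n k"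
    and "k = 1 \<Longrightarrow> optimal n \<alpha> (return_pmf (threshold_policy signal_time))"
proof -
  have n: "1 \<le> n" and k: "k \<in> {1..n}" using assms(2) by (auto simp: is_threshold_def)
  have opt: "optimal n \<alpha> (return_pmf p) \<and> OPT n \<alpha> = threshold_value \<alpha> n k"
    if p: "\<And>r s t. 1 \<le> s \<Longrightarrow> 1 \<le> t \<Longrightarrow> p (code_history r s t) \<longleftrightarrow> max s k \<le> t \<and> r t = 1" for p
  proof -
    have eq: "det_success n \<alpha> p = threshold_value \<alpha> n k"
      by (rule det_success_threshold_policy[OF k p])
    have le: "det_success n \<alpha> q \<le> det_success n \<alpha> p" for q
      unfolding eq by (rule det_success_le_threshold_value[OF assms])
    show ?thesis using optimal_return_pmfI[OF assms(1) n le] eq by simp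
  qed
  show "optimal n \<alpha> (return_pmf (threshold_policy (\<lambda>h. max (signal_time h) (enat k))))"
    "OPT n \<alpha> = threshold_value \<alpha> n k"
    using opt[OF threshold_policy_code_history(2)] by blast+
  show "optimal n \<alpha> (return_pmf (threshold_policy signal_time))" if "k = 1"
  proof (rule opt[THEN conjunct1])
    fix r and s t :: nat assume "1 \<le> s" "1 \<le> t"
    then show "threshold_policy signal_time (code_history r s t) \<longleftrightarrow> max s k \<le> t \<and> r t = 1"
      by (simp add: that threshold_policy_code_history(1))
  qed
qed

lemma is_threshold_1:
  assumes "\<alpha> \<ge> 1" "1 \<le> n"
  shows "is_threshold \<alpha> n 1"
  using assms record_tail_le_ge_1 by (auto simp: is_threshold_def)

text \<open>Take the first time at which accepting is no worse than waiting; \<open>n\<close> is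
  such a time, its tail being empty, and \<open>record_tail_le_mono\<close> carries the property
  onwards.\<close>

lemma ex_threshold:
  assumes "\<alpha> \<le> 1" "1 \<le> n"
  shows "\<exists>k. is_threshold \<alpha> n k"
proof -
  define ok where "ok k \<longleftrightarrow> 1 \<le> k \<and> record_tail \<alpha> n k \<le> real k powr - \<alpha>" for k
  define k where "k = (LEAST k. ok k)"
  have "ok n" using assms(2) by (simp add: ok_def)
  then have k: "ok k" "k \<le> n" unfolding k_def by (rule LeastI, rule Least_le)
  have "real t powr - \<alpha> \<le> record_tail \<alpha> n t" if "t \<in> {1..<k}" for t
    using not_less_Least[of t ok] that by (auto simp: k_def ok_def)
  moreover have "record_tail \<alpha> n t \<le> real t powr - \<alpha>" if "t \<in> {k..n}" for t
    by (rule record_tail_le_mono[OF assms(1), of k]) (use that k in \<open>simp_all add: ok_def\<close>)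
  ultimately have "is_threshold \<alpha> n k"
    using k assms(1) by (auto simp: is_threshold_def ok_def)
  then show ?thesis ..
qed

subsection \<open>Asymptotics\<close>

text \<open>Since \<open>\<alpha> < 1\<close>, given \<open>T\<close> there is a fixed
  \<open>t \<ge> T\<close> with \<open>(t / (t + 1)) powr \<alpha> > \<alpha>\<close>. If
  \<open>k n < T\<close>, then accepting at \<open>t\<close> is no worse, which contradicts
  \<open>threshold_ratio_lower\<close> for large \<open>n\<close>.\<close>

lemma threshold_at_top:
  assumes "0 < \<alpha>" "\<alpha> < 1" and k: "\<And>n. 1 \<le> n \<Longrightarrow> is_threshold \<alpha> n (k n)"
  shows "filterlim k at_top sequentially"
  unfolding filterlim_at_top
proof
  fix T
  have "(\<lambda>t. (real t / (real t + 1)) powr \<alpha>) \<longlonglongrightarrow> 1" by real_asymp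
  then have "\<forall>\<^sub>F t in sequentially. \<alpha> < (real t / (real t + 1)) powr \<alpha>"
    using assms(2) by (rule order_tendstoD)
  then have "\<forall>\<^sub>F t in sequentially. \<alpha> < (real t / (real t + 1)) powr \<alpha> \<and> max 1 T \<le> t"
    using eventually_ge_at_top by (rule eventually_conj)
  then obtain t where t: "\<alpha> < (real t / (real t + 1)) powr \<alpha>" "1 \<le> t" "T \<le> t"
    by (auto dest!: eventually_happens)
  have "(\<lambda>n. (real t / (real n + 1)) powr \<alpha>) \<longlonglongrightarrow> 0" using t(2) assms(1) by real_asymp
  then have "\<forall>\<^sub>F n in sequentially.
      (real t / (real n + 1)) powr \<alpha> < (real t / (real t + 1)) powr \<alpha> - \<alpha>"
    using t(1) by (intro order_tendstoD) auto
  then show "\<forall>\<^sub>F n in sequentially. T \<le> k n"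
    using eventually_ge_at_top[of t]
  proof eventually_elim
    case (elim n)
    show ?case
    proof (rule ccontr)
      assume "\<not> T \<le> k n"
      then have "record_tail \<alpha> n t \<le> real t powr - \<alpha>"
        using k[of n] t elim by (auto simp: is_threshold_def)
      with threshold_ratio_lower[OF assms(1) t(2)] elim show False by fastforce
    qed
  qed
qed

lemma threshold_ratio_tendsto:
  assumes \<alpha>: "0 < \<alpha>" "\<alpha> < 1" and k: "\<And>n. 1 \<le> n \<Longrightarrow> is_threshold \<alpha> n (k n)"
  shows "(\<lambda>n. real (k n) / real n) \<longlonglongrightarrow> (1 - \<alpha>) powr (1 / \<alpha>)"
proof -
  have top: "filterlim k at_top sequentially" by (rule threshold_at_top[OF assms])
  \<comment> \<open>\<open>lo\<close> comes from \<open>threshold_ratio_lower\<close> at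
    \<open>k n\<close>, and \<open>hi\<close> from \<open>threshold_ratio_upper\<close> at
    \<open>k n - 1\<close>, its last factor turning \<open>k n - 1\<close> back into
    \<open>k n\<close>.\<close>
  define lo where "lo t = (real t / (real t + 1)) powr \<alpha> - \<alpha>" for t
  define hi where "hi t = (((real t - 1) / (real t - 2)) powr \<alpha> - \<alpha>) * (real t / (real t - 1)) powr \<alpha>"
    for t
  have lo: "lo \<longlonglongrightarrow> 1 - \<alpha>" unfolding lo_def by real_asymp
  have hi: "hi \<longlonglongrightarrow> 1 - \<alpha>" unfolding hi_def by real_asymp
  have "(\<lambda>n. (real (k n) / real n) powr \<alpha>) \<longlonglongrightarrow> 1 - \<alpha>"
  proof (rule tendsto_sandwich)
    show "(\<lambda>n. lo (k n)) \<longlonglongrightarrow> 1 - \<alpha>" by (rule filterlim_compose[OF lo top])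
    show "(\<lambda>n. hi (k n)) \<longlonglongrightarrow> 1 - \<alpha>" by (rule filterlim_compose[OF hi top])
    show "\<forall>\<^sub>F n in sequentially. lo (k n) \<le> (real (k n) / real n) powr \<alpha>"
      using eventually_ge_at_top[of 1]
    proof eventually_elim
      case (elim n)
      have "lo (k n) \<le> (real (k n) / (real n + 1)) powr \<alpha>"
        unfolding lo_def using k[OF elim] \<alpha>
        by (intro threshold_ratio_lower) (auto simp: is_threshold_def)
      also have "\<dots> \<le> (real (k n) / real n) powr \<alpha>"
        using elim \<alpha> by (intro powr_mono2 divide_left_mono) auto
      finally show ?case .
    qed
    \<comment> \<open>This ensures \<open>2 \<le> k n - 1\<close>, as
      \<open>threshold_ratio_upper\<close> demands.\<close>
    have "\<forall>\<^sub>F n in sequentially. 3 \<le> k n"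
      using top unfolding filterlim_at_top by blast
    then show "\<forall>\<^sub>F n in sequentially. (real (k n) / real n) powr \<alpha> \<le> hi (k n)"
      using eventually_ge_at_top[of 1]
    proof eventually_elim
      case (elim n)
      obtain u where u: "k n = Suc u" "2 \<le> u" using elim by (cases "k n") auto
      have "u < n" "real u powr - \<alpha> \<le> record_tail \<alpha> n u"
        using k[of n] elim u by (auto simp: is_threshold_def)
      then have "(real u / (real n - 1)) powr \<alpha> \<le> (real u / (real u - 1)) powr \<alpha> - \<alpha>"
        using u \<alpha> by (intro threshold_ratio_upper) auto
      then have "(real u / (real n - 1)) powr \<alpha> * (real (k n) / real u) powr \<alpha> \<le> hi (k n)"
        unfolding hi_def u by (auto intro: mult_right_mono)
      moreover have "(real (k n) / real n) powr \<alpha>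
          \<le> (real u / (real n - 1) * (real (k n) / real u)) powr \<alpha>"
        using u \<open>u < n\<close> \<alpha> by (intro powr_mono2) (auto intro: divide_left_mono)
      moreover have "\<dots> = (real u / (real n - 1)) powr \<alpha> * (real (k n) / real u) powr \<alpha>"
        using \<open>u < n\<close> by (intro powr_mult)
      ultimately show ?case by linarith
    qed
  qed
  then have "(\<lambda>n. ((real (k n) / real n) powr \<alpha>) powr (1 / \<alpha>)) \<longlonglongrightarrow> (1 - \<alpha>) powr (1 / \<alpha>)"
    using \<alpha> by (intro tendsto_powr) auto
  then show ?thesis using \<alpha> by (simp add: powr_powr)
qed

section \<open>Averaging over the signal time\<close>

definition signal_moment :: "real \<Rightarrow> nat \<Rightarrow> real" where
  "signal_moment \<alpha> j = (\<Sum>s=1..j. signal_increment \<alpha> s * (real s - 1))"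

text \<open>Summation by parts.\<close>

lemma signal_moment_eq: "signal_moment \<alpha> j = real j powr \<alpha> * (real j - 1) - power_sum \<alpha> j"
proof (induction j)
  case 0
  then show ?case by (simp add: signal_moment_def power_sum_def)
next
  case (Suc j)
  have "signal_moment \<alpha> (Suc j) = signal_moment \<alpha> j + signal_increment \<alpha> (Suc j) * real j"
    by (simp add: signal_moment_def)
  also have "\<dots> = real j powr \<alpha> * (real j - 1) - power_sum \<alpha> j
      + (real (Suc j) powr \<alpha> - real j powr \<alpha>) * real j"
    by (simp add: Suc.IH signal_increment_def)
  also have "\<dots> = real (Suc j) powr \<alpha> * (real (Suc j) - 1) - power_sum \<alpha> (Suc j)"
    unfolding power_sum_Suc by (simp add: algebra_simps)
  finally show ?case .
qed

text \<open>For \<open>j \<ge> 2\<close> this is the conditional mean of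
  \<open>(S - 1) / (j - 1)\<close> given \<open>I = j\<close>: the chance that the best of the
  earlier items came before the signal, in which case the first record from \<open>S\<close> on is
  the best item.\<close>

definition signal_mean :: "real \<Rightarrow> nat \<Rightarrow> real" where
  "signal_mean \<alpha> j = real j powr - \<alpha> / (real j - 1) * signal_moment \<alpha> j"

lemma signal_mean_tendsto:
  assumes "\<alpha> > 0"
  shows "signal_mean \<alpha> \<longlonglongrightarrow> \<alpha> / (\<alpha> + 1)"
proof -
  have eq: "\<forall>\<^sub>F j in sequentially.
      1 - power_sum \<alpha> j / real j powr (\<alpha> + 1) * (real j / (real j - 1)) = signal_mean \<alpha> j"
    using eventually_gt_at_top[of 1]
  proof eventually_elim
    case (elim j)
    then have j: "real j > 1" by simp
    have *: "p / d * (q * d - r) = p * q - r * p / d" if "d \<noteq> 0" for p q r d :: real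
      using that by (simp add: field_simps)
    have "signal_mean \<alpha> j = real j powr - \<alpha> * real j powr \<alpha>
        - power_sum \<alpha> j * real j powr - \<alpha> / (real j - 1)"
      unfolding signal_mean_def signal_moment_eq using j by (intro *) simp
    also have "\<dots> = 1 - power_sum \<alpha> j * real j powr - \<alpha> / (real j - 1)"
      using j by (simp flip: powr_add)
    also have "\<dots> = 1 - power_sum \<alpha> j / real j powr (\<alpha> + 1) * (real j / (real j - 1))"
      using j by (simp add: powr_add powr_minus_divide)
    finally show ?case ..
  qed
  have "(\<lambda>j::nat. real j / (real j - 1)) \<longlonglongrightarrow> 1" by real_asymp
  then have "(\<lambda>j. 1 - power_sum \<alpha> j / real j powr (\<alpha> + 1) * (real j / (real j - 1)))
      \<longlonglongrightarrow> 1 - 1 / (\<alpha> + 1) * 1"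
    by (intro tendsto_intros power_sum_asymp assms)
  also have "1 - 1 / (\<alpha> + 1) * 1 = \<alpha> / (\<alpha> + 1)" using assms by (simp add: field_simps)
  finally show ?thesis using eq by (rule Lim_transform_eventually)
qed

text \<open>At \<open>j = k\<close> every maximum equals \<open>k\<close>, and the increments
  telescope to \<open>real k powr \<alpha>\<close>; by \<open>signal_moment_eq\<close> the excess
  over the moment is \<open>power_sum \<alpha> k\<close>. For \<open>s > k\<close> the maximum has
  no effect.\<close>

lemma sum_signal_max:
  assumes "\<alpha> > 0" "1 \<le> k" "k \<le> j"
  shows "(\<Sum>s=1..j. signal_increment \<alpha> s * (real (max s k) - 1)) = signal_moment \<alpha> j + power_sum \<alpha> k"
  using assms(3)
proof (induction j rule: dec_induct)
  case base
  have "(\<Sum>s=1..k. signal_increment \<alpha> s * (real (max s k) - 1))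
      = (\<Sum>s=1..k. signal_increment \<alpha> s) * (real k - 1)"
    unfolding sum_distrib_right by (intro sum.cong) (auto simp: max_def)
  also have "(\<Sum>s=1..k. signal_increment \<alpha> s) = real k powr \<alpha>"
    unfolding signal_increment_def by (rule sum_powr_diff[OF assms(1)])
  finally show ?case by (simp add: signal_moment_eq)
next
  case (step j)
  then show ?case by (simp add: signal_moment_def max_def)
qed

text \<open>Exchanging the sums collects for each record time \<open>j\<close> all signal times
  \<open>s \<le> j\<close>, to which \<open>sum_signal_max\<close> applies.\<close>

lemma threshold_value_eq:
  assumes "\<alpha> > 0" "k \<in> {1..n}"
  shows "real n * threshold_value \<alpha> n k = of_bool (k = 1) + (\<Sum>j=k..n. signal_mean \<alpha> j)
    + power_sum \<alpha> k * record_tail \<alpha> n (k - 1)"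
proof -
  let ?c = "\<lambda>j. real j powr - \<alpha> / (real j - 1)"
  \<comment> \<open>For \<open>m = 1\<close> the factor \<open>real m - 1\<close> removes the sum,
    including the term \<open>j = 1\<close> with zero denominator; the certain record at time 1 is
    accounted for by \<open>of_bool\<close>.\<close>
  have frv: "real n * first_record_value \<alpha> n m = of_bool (m = 1) + (\<Sum>j=m..n. (real m - 1) * ?c j)"
    if "1 \<le> m" for m
    using that assms(2)
    by (simp add: first_record_value_def record_tail_def sum_distrib_left)
  have one: "(\<Sum>s=1..n. signal_increment \<alpha> s * of_bool (max s k = 1)) = of_bool (k = 1)"
  proof -
    have "(\<Sum>s=1..n. signal_increment \<alpha> s * of_bool (max s k = 1))
        = (\<Sum>s=1..n. if s = 1 then of_bool (k = 1) else 0)"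
      using assms by (intro sum.cong) (auto simp: signal_increment_def max_def)
    also have "\<dots> = of_bool (k = 1)" using assms(2) by simp
    finally show ?thesis .
  qed
  have "real n * threshold_value \<alpha> n k
      = (\<Sum>s=1..n. signal_increment \<alpha> s * (real n * first_record_value \<alpha> n (max s k)))"
    unfolding threshold_value_def sum_distrib_left by (simp add: mult_ac)
  also have "\<dots> = (\<Sum>s=1..n. signal_increment \<alpha> s * of_bool (max s k = 1)
      + (\<Sum>j=max s k..n. signal_increment \<alpha> s * ((real (max s k) - 1) * ?c j)))"
    by (intro sum.cong refl) (simp only: frv sum_distrib_left distrib_left atLeastAtMost_iff max.coboundedI1)
  also have "\<dots> = of_bool (k = 1)
      + (\<Sum>s=1..n. \<Sum>j=max s k..n. signal_increment \<alpha> s * ((real (max s k) - 1) * ?c j))"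
    unfolding sum.distrib one ..
  also have "(\<Sum>s=1..n. \<Sum>j=max s k..n. signal_increment \<alpha> s * ((real (max s k) - 1) * ?c j))
      = (\<Sum>s\<in>{1..n}. \<Sum>j\<in>{j \<in> {k..n}. s \<le> j}. signal_increment \<alpha> s * ((real (max s k) - 1) * ?c j))"
    by (intro sum.cong refl) auto
  also have "\<dots> = (\<Sum>j\<in>{k..n}. \<Sum>s\<in>{s \<in> {1..n}. s \<le> j}. signal_increment \<alpha> s * ((real (max s k) - 1) * ?c j))"
    by (rule sum.swap_restrict) auto
  also have "\<dots> = (\<Sum>j=k..n. signal_mean \<alpha> j + power_sum \<alpha> k * ?c j)"
  proof (intro sum.cong refl)
    fix j assume j: "j \<in> {k..n}"
    then have "{s \<in> {1..n}. s \<le> j} = {1..j}" by auto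
    then have "(\<Sum>s\<in>{s \<in> {1..n}. s \<le> j}. signal_increment \<alpha> s * ((real (max s k) - 1) * ?c j))
        = (\<Sum>s=1..j. signal_increment \<alpha> s * (real (max s k) - 1)) * ?c j"
      by (simp only: sum_distrib_right mult.assoc)
    also have "\<dots> = (signal_moment \<alpha> j + power_sum \<alpha> k) * ?c j"
      using sum_signal_max[OF assms(1), of k j] assms(2) j by simp
    finally show "(\<Sum>s\<in>{s \<in> {1..n}. s \<le> j}. signal_increment \<alpha> s * ((real (max s k) - 1) * ?c j))
      = signal_mean \<alpha> j + power_sum \<alpha> k * ?c j"
      by (simp only: signal_mean_def distrib_right mult.commute)
  qed
  also have "\<dots> = (\<Sum>j=k..n. signal_mean \<alpha> j) + power_sum \<alpha> k * record_tail \<alpha> n (k - 1)"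
    using assms(2) by (simp add: sum.distrib sum_distrib_left record_tail_def)
  finally show ?thesis by (simp only: add.assoc)
qed

lemma threshold_value_1_tendsto:
  assumes "\<alpha> > 0"
  shows "(\<lambda>n. threshold_value \<alpha> n 1) \<longlonglongrightarrow> \<alpha> / (\<alpha> + 1)"
proof -
  have "(\<lambda>n. 1 / real n) \<longlonglongrightarrow> 0" by real_asymp
  from tendsto_add[OF this tendsto_cesaro_mean[OF signal_mean_tendsto[OF assms]]]
  have lim: "(\<lambda>n. 1 / real n + (\<Sum>j=1..n. signal_mean \<alpha> j) / real n) \<longlonglongrightarrow> \<alpha> / (\<alpha> + 1)"
    by simp
  have eq: "\<forall>\<^sub>F n in sequentially.
      1 / real n + (\<Sum>j=1..n. signal_mean \<alpha> j) / real n = threshold_value \<alpha> n 1"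
    using eventually_ge_at_top[of 1]
  proof eventually_elim
    case (elim n)
    then have "real n * threshold_value \<alpha> n 1 = 1 + (\<Sum>j=1..n. signal_mean \<alpha> j)"
      using threshold_value_eq[OF assms, of 1 n] by (simp add: power_sum_def)
    then show ?case using elim by (simp add: field_simps)
  qed
  show ?thesis by (rule Lim_transform_eventually[OF lim eq])
qed

text \<open>Waiting is no worse at \<open>k - 1\<close>, which bounds the tail there below by
  \<open>(k - 1) powr - \<alpha>\<close>; one recursion step from \<open>k\<close>, where accepting
  is no worse, bounds it above by \<open>k powr - \<alpha> * (1 + 1 / (k - 1))\<close>.\<close>

lemma record_tail_threshold_asymp:
  assumes \<alpha>: "0 < \<alpha>" "\<alpha> < 1" and k: "\<And>n. 1 \<le> n \<Longrightarrow> is_threshold \<alpha> n (k n)"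
  shows "(\<lambda>n. real (k n) powr \<alpha> * record_tail \<alpha> n (k n - 1)) \<longlonglongrightarrow> 1"
proof (rule tendsto_sandwich)
  have top: "filterlim k at_top sequentially" by (rule threshold_at_top[OF assms])
  have "\<forall>\<^sub>F n in sequentially. 2 \<le> k n"
    using top unfolding filterlim_at_top by blast
  then have ev: "\<forall>\<^sub>F n in sequentially. 1 \<le> n \<and> 2 \<le> k n"
    by (intro eventually_conj eventually_ge_at_top)
  have ineq: "1 \<le> real (k n) powr \<alpha> * record_tail \<alpha> n (k n - 1)
    \<and> real (k n) powr \<alpha> * record_tail \<alpha> n (k n - 1) \<le> 1 + 1 / (real (k n) - 1)"
    if n: "1 \<le> n" "2 \<le> k n" for n
  proof -
    obtain u where u: "k n = Suc u" "1 \<le> u" using n by (cases "k n") auto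
    have un: "u < n" and lo: "real u powr - \<alpha> \<le> record_tail \<alpha> n u"
      using k[OF n(1)] u by (auto simp: is_threshold_def)
    have "\<forall>t\<in>{k n..n}. record_tail \<alpha> n t \<le> real t powr - \<alpha>"
      using k[OF n(1)] by (simp add: is_threshold_def)
    then have "record_tail \<alpha> n (k n) \<le> real (k n) powr - \<alpha>"
      by (rule bspec) (use u un in simp)
    then have hi: "record_tail \<alpha> n (Suc u) \<le> real (Suc u) powr - \<alpha>"
      by (simp only: u(1))
    have inv: "real (Suc u) powr \<alpha> * real (Suc u) powr - \<alpha> = 1"
      by (simp flip: powr_add)
    have "1 = real (Suc u) powr \<alpha> * real (Suc u) powr - \<alpha>" using inv ..
    also have "\<dots> \<le> real (Suc u) powr \<alpha> * real u powr - \<alpha>"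
      using u \<alpha> by (intro mult_left_mono powr_mono2') auto
    also have "\<dots> \<le> real (Suc u) powr \<alpha> * record_tail \<alpha> n u"
      using lo by (intro mult_left_mono) auto
    finally have "1 \<le> real (Suc u) powr \<alpha> * record_tail \<alpha> n u" .
    moreover have "record_tail \<alpha> n u \<le> real (Suc u) powr - \<alpha> * (1 + 1 / real u)"
      using hi by (simp add: record_tail_step[OF un] algebra_simps)
    then have "real (Suc u) powr \<alpha> * record_tail \<alpha> n u
        \<le> real (Suc u) powr \<alpha> * (real (Suc u) powr - \<alpha> * (1 + 1 / real u))"
      by (intro mult_left_mono) auto
    then have "real (Suc u) powr \<alpha> * record_tail \<alpha> n u \<le> 1 + 1 / real u"
      by (simp only: inv mult.assoc[symmetric] mult_1_left)
    ultimately show ?thesis by (simp add: u)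
  qed
  show "\<forall>\<^sub>F n in sequentially. 1 \<le> real (k n) powr \<alpha> * record_tail \<alpha> n (k n - 1)"
    using ev by (rule eventually_mono) (use ineq in blast)
  show "\<forall>\<^sub>F n in sequentially.
      real (k n) powr \<alpha> * record_tail \<alpha> n (k n - 1) \<le> 1 + 1 / (real (k n) - 1)"
    using ev by (rule eventually_mono) (use ineq in blast)
  have "(\<lambda>t::nat. 1 + 1 / (real t - 1)) \<longlonglongrightarrow> 1" by real_asymp
  then show "(\<lambda>n. 1 + 1 / (real (k n) - 1)) \<longlonglongrightarrow> 1" using top by (rule filterlim_compose)
qed simp

lemma threshold_value_tendsto:
  assumes \<alpha>: "0 < \<alpha>" "\<alpha> < 1" and k: "\<And>n. 1 \<le> n \<Longrightarrow> is_threshold \<alpha> n (k n)"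
  shows "(\<lambda>n. threshold_value \<alpha> n (k n))
    \<longlonglongrightarrow> (\<alpha> + (1 - \<alpha>) powr (1 + 1 / \<alpha>)) / (\<alpha> + 1)"
proof -
  let ?q = "signal_mean \<alpha>" and ?P = "power_sum \<alpha>" and ?\<kappa> = "(1 - \<alpha>) powr (1 / \<alpha>)"
  let ?L = "\<alpha> / (\<alpha> + 1)"
  \<comment> \<open>\<open>threshold_value_eq\<close> divided by \<open>n\<close> and regrouped into
    convergent factors. The sum from \<open>k n\<close> to \<open>n\<close> becomes a difference of
    two Cesaro means, with the term at \<open>k n\<close> restored.\<close>
  let ?v = "\<lambda>n. (\<Sum>j=1..n. ?q j) / real n
      - real (k n) / real n * ((\<Sum>j=1..k n. ?q j) / real (k n)) + ?q (k n) * (1 / real n)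
      + ?P (k n) / real (k n) powr (\<alpha> + 1) * (real (k n) / real n)
        * (real (k n) powr \<alpha> * record_tail \<alpha> n (k n - 1))"
  have top: "filterlim k at_top sequentially" by (rule threshold_at_top[OF assms])
  have q: "?q \<longlonglongrightarrow> ?L" by (rule signal_mean_tendsto[OF \<alpha>(1)])
  note mean = tendsto_cesaro_mean[OF q]
  have "(\<lambda>n. 1 / real n) \<longlonglongrightarrow> 0" by real_asymp
  then have lim: "?v \<longlonglongrightarrow> ?L - ?\<kappa> * ?L + ?L * 0 + 1 / (\<alpha> + 1) * ?\<kappa> * 1"
    by (intro tendsto_add tendsto_diff tendsto_mult mean filterlim_compose[OF mean top] filterlim_compose[OF q top]
        filterlim_compose[OF power_sum_asymp[OF \<alpha>(1)] top] threshold_ratio_tendsto[OF assms]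
        record_tail_threshold_asymp[OF assms])
  have limit: "?L - ?\<kappa> * ?L + ?L * 0 + 1 / (\<alpha> + 1) * ?\<kappa> * 1
      = (\<alpha> + (1 - \<alpha>) powr (1 + 1 / \<alpha>)) / (\<alpha> + 1)"
  proof -
    have "?L - ?\<kappa> * ?L + ?L * 0 + 1 / (\<alpha> + 1) * ?\<kappa> * 1 = (\<alpha> + (1 - \<alpha>) * ?\<kappa>) / (\<alpha> + 1)"
      by (simp add: left_diff_distrib diff_divide_distrib add_divide_distrib mult.commute)
    also have "(1 - \<alpha>) * ?\<kappa> = (1 - \<alpha>) powr (1 + 1 / \<alpha>)"
      using \<alpha> by (simp only: powr_add) simp
    finally show ?thesis .
  qed
  have "\<forall>\<^sub>F n in sequentially. 2 \<le> k n"
    using top unfolding filterlim_at_top by blast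
  then have eq: "\<forall>\<^sub>F n in sequentially. ?v n = threshold_value \<alpha> n (k n)"
    using eventually_ge_at_top[of 1]
  proof eventually_elim
    case (elim n)
    have kn: "k n \<in> {1..n}" using k elim by (simp add: is_threshold_def)
    have "{1..n} = {1..k n} \<union> {k n<..n}" using kn by auto
    then have "(\<Sum>j=1..n. ?q j) = (\<Sum>j=1..k n. ?q j) + (\<Sum>j\<in>{k n<..n}. ?q j)"
      by (simp only:) (intro sum.union_disjoint, auto)
    moreover have "(\<Sum>j=k n..n. ?q j) = ?q (k n) + (\<Sum>j\<in>{k n<..n}. ?q j)"
      using kn by (intro sum.head) simp
    ultimately have split: "(\<Sum>j=k n..n. ?q j) = (\<Sum>j=1..n. ?q j) - (\<Sum>j=1..k n. ?q j) + ?q (k n)"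
      by simp
    have pos: "real n > 0" "real (k n) > 0" using kn by auto
    have *: "N * (A / N - K / N * (B / K) + Q * (1 / N) + P / (T * K) * (K / N) * (T * R))
        = A - B + Q + P * R" if "N > 0" "K > 0" "T > 0" for N A K B Q P T R :: real
      using that by (simp add: field_simps)
    have "real (k n) powr (\<alpha> + 1) = real (k n) powr \<alpha> * real (k n)"
      using pos by (simp add: powr_add)
    then have "real n * ?v n = (\<Sum>j=1..n. ?q j) - (\<Sum>j=1..k n. ?q j) + ?q (k n)
        + ?P (k n) * record_tail \<alpha> n (k n - 1)"
      using pos by (simp only:) (intro *, simp_all)
    also have "\<dots> = real n * threshold_value \<alpha> n (k n)"
      unfolding threshold_value_eq[OF \<alpha>(1) kn] split using elim by simp
    finally have "real n * ?v n = real n * threshold_value \<alpha> n (k n)" .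
    then show ?case using pos(1) by simp
  qed
  show ?thesis using Lim_transform_eventually[OF lim eq] unfolding limit .
qed

theorem theorem2:
  fixes \<alpha> :: real
  assumes "\<alpha> > 0"
  shows "(\<alpha> \<ge> 1 \<longrightarrow> (\<forall>n\<ge>1. optimal n \<alpha> (return_pmf (threshold_policy signal_time)))) \<and>
    (\<alpha> < 1 \<longrightarrow> (\<exists>k :: nat \<Rightarrow> nat.
        (\<forall>n\<ge>1. k n \<in> {1..n} \<and>
           optimal n \<alpha>
             (return_pmf (threshold_policy (\<lambda>h. max (signal_time h) (enat (k n)))))) \<and>
        (\<lambda>n. real (k n) / real n) \<longlonglongrightarrow> (1 - \<alpha>) powr (1 / \<alpha>))) \<and>
    (\<lambda>n. OPT n \<alpha>) \<longlonglongrightarrow> OPT_limit \<alpha>"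
proof (cases "\<alpha> < 1")
  case False
  then have thr: "is_threshold \<alpha> n 1" if "n \<ge> 1" for n
    using that by (intro is_threshold_1) auto
  have "\<forall>\<^sub>F n in sequentially. threshold_value \<alpha> n 1 = OPT n \<alpha>"
    using eventually_ge_at_top[of 1]
    by eventually_elim (simp add: optimal_threshold_policy(2)[OF assms thr])
  from Lim_transform_eventually[OF threshold_value_1_tendsto[OF assms] this]
  have "(\<lambda>n. OPT n \<alpha>) \<longlonglongrightarrow> OPT_limit \<alpha>" using False by (simp add: OPT_limit_def)
  then show ?thesis using False optimal_threshold_policy(3)[OF assms thr] by simp
next
  case True
  then have "\<forall>n. \<exists>k. 1 \<le> n \<longrightarrow> is_threshold \<alpha> n k"
    using ex_threshold[of \<alpha>] by auto
  then obtain k where k: "is_threshold \<alpha> n (k n)" if "1 \<le> n" for n by metis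
  have "\<forall>\<^sub>F n in sequentially. threshold_value \<alpha> n (k n) = OPT n \<alpha>"
    using eventually_ge_at_top[of 1]
    by eventually_elim (simp add: optimal_threshold_policy(2)[OF assms k])
  from Lim_transform_eventually[OF threshold_value_tendsto[OF assms True k] this]
  have "(\<lambda>n. OPT n \<alpha>) \<longlonglongrightarrow> OPT_limit \<alpha>" using True by (simp add: OPT_limit_def)
  moreover have "\<forall>n\<ge>1. k n \<in> {1..n} \<and>
      optimal n \<alpha> (return_pmf (threshold_policy (\<lambda>h. max (signal_time h) (enat (k n)))))"
    using k optimal_threshold_policy(1)[OF assms k] by (simp add: is_threshold_def)
  ultimately show ?thesis
    using True threshold_ratio_tendsto[OF assms True k] by auto
qed

end
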